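(* Let $d\ge2$, $I=[0,1]$, let $\gamma:I\to\mathbb R^d$ be a smooth curve of finite type, and let $0<\alpha\le d$. Then there exist a positive Borel measure $\mu$ on $\mathbb R^d$ and a constant $C_\mu$ with $\mu(B(x,\rho))\le C_\mu\rho^\alpha$ for all $x\in\mathbb R^d$, $\rho>0$, such that the following holds. If $1\le p,q\le\infty$ and there is a constant $C$ such that \[ \|T_\lambda^\gamma[w_\gamma^\alpha,f]\|_{L^q(d\mu)}\le C\lambda^{-\frac\alpha q}\|f\|_{L^p(w_\gamma^\alpha dt)}\quad\text{for all }\lambda\ge1\text{ and all } f\in L^p(I,w_\gamma^\alpha dt), \] then \[ \frac{\beta(\alpha)}{q}+\frac1p\le1 . \] Likewise, if in addition $\det(\gamma'(t),\dots,\gamma^{(d)}(t))\neq0$ for all $t\in I$, and there is a constant $C$ such that $\|T_\lambda^\gamma f\|_{L^q(d\mu)}\le C\lambda^{-\frac\alpha q}\|f\|_{L^p(I)}$ for all $\lambda\ge1$ and all $f\in L^p(I)$, then $\frac{\beta(\alpha)}{q}+\frac1p\le1$.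
   Context: $B(x,\rho)$ is the ball in $\mathbb R^d$ of radius $\rho$ centred at $x$. For $0<\alpha\le d$, $\beta(\alpha)=(j+1)\alpha+\frac{(d-j-1)(d-j)}{2}$ if $d-j-1<\alpha\le d-j$, $j=0,\dots,d-1$. $T_\lambda^\gamma f(x)=\int_I e^{i\lambda x\cdot\gamma(t)}f(t)\,dt$ and, for a weight $w$ on $I$, $T_\lambda^\gamma[w,f](x)=\int_I e^{i\lambda x\cdot\gamma(t)}f(t)w(t)\,dt$, $x\in\mathbb R^d$. The weight $w_\gamma^\alpha$ is $w_\gamma^\alpha(t)=|\det(\gamma'(t),\gamma''(t),\dots,\gamma^{(d)}(t))|^{1/\beta(\alpha)}$. A smooth curve $\gamma:I\to\mathbb R^d$ is of finite type if for every $t\in I$ there exist positive integers $a_1<a_2<\dots<a_d$ such that $\det(\gamma^{(a_1)}(t),\dots,\gamma^{(a_d)}(t))\ne0$. *)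

theory Defs
  imports "HOL-Probability.Probability"
begin

text \<open>
  The exponent ranges over \<open>ennreal\<close>, so that \<open>p = \<infinity>\<close> is included; there \<open>1 / \<infinity> = 0\<close>.
  The norm is itself \<open>ennreal\<close>-valued, so an estimate with a finite right-hand side includes the
  assertion that the left-hand side is finite.
\<close>

definition Lp_norm :: "'a measure \<Rightarrow> ennreal \<Rightarrow> ('a \<Rightarrow> complex) \<Rightarrow> ennreal" where
  "Lp_norm M p f =
     (if p = \<infinity> then esssup M (\<lambda>x. ennreal (norm (f x)))
      else (let J = \<integral>\<^sup>+ x. ennreal (norm (f x) powr enn2real p) \<partial>M
            in if J = \<infinity> then \<infinity> else ennreal (enn2real J powr enn2real (1 / p))))"

definition Lp_space :: "'a measure \<Rightarrow> ennreal \<Rightarrow> ('a \<Rightarrow> complex) set" where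
  "Lp_space M p = {f \<in> borel_measurable M. Lp_norm M p f < \<infinity>}"

text \<open>Derivatives are taken within \<open>[0,1]\<close>, hence they are one-sided at the endpoints, and only
  the values of the curve on \<open>[0,1]\<close> matter.\<close>

definition nderiv :: "nat \<Rightarrow> (real \<Rightarrow> 'a::real_normed_vector) \<Rightarrow> real \<Rightarrow> 'a" where
  "nderiv k \<gamma> = ((\<lambda>g t. vector_derivative g (at t within {0..1})) ^^ k) \<gamma>"

definition smooth_curve :: "(real \<Rightarrow> 'a::real_normed_vector) \<Rightarrow> bool" where
  "smooth_curve \<gamma> \<longleftrightarrow> (\<forall>k. \<forall>t\<in>{0..1}. nderiv k \<gamma> differentiable (at t within {0..1}))"

text \<open>
  \<open>det_cols v\<close> is the determinant with columns \<open>v 1, \<dots>, v d\<close>, where \<open>d = CARD('n)\<close>. The index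
  type carries no order, so its elements are enumerated by the bijection \<open>to_nat_on UNIV\<close> onto
  \<open>{..<d}\<close>. Another enumeration can only change the sign, and below only the absolute value and
  the vanishing of such determinants are used.
\<close>

definition det_cols :: "(nat \<Rightarrow> real ^ 'n) \<Rightarrow> real" where
  "det_cols v = det (\<chi> i j. v (Suc (to_nat_on (UNIV :: 'n set) j)) $ i)"

definition torsion :: "(real \<Rightarrow> real ^ 'n) \<Rightarrow> real \<Rightarrow> real" where
  "torsion \<gamma> t = det_cols (\<lambda>k. nderiv k \<gamma> t)"

definition finite_type :: "(real \<Rightarrow> real ^ 'n) \<Rightarrow> bool" where
  "finite_type \<gamma> \<longleftrightarrow>
     (\<forall>t\<in>{0..1}. \<exists>a :: nat \<Rightarrow> nat. (\<forall>k\<in>{1..CARD('n)}. 0 < a k) \<and>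
        strict_mono_on {1..CARD('n)} a \<and> det_cols (\<lambda>k. nderiv (a k) \<gamma> t) \<noteq> 0)"

definition beta :: "nat \<Rightarrow> real \<Rightarrow> real" where
  "beta d \<alpha> =
     (let j = (THE j. j < d \<and> real d - real j - 1 < \<alpha> \<and> \<alpha> \<le> real d - real j)
      in (real j + 1) * \<alpha> + (real d - real j - 1) * (real d - real j) / 2)"

definition weight :: "(real \<Rightarrow> real ^ 'n) \<Rightarrow> real \<Rightarrow> real \<Rightarrow> real" where
  "weight \<gamma> \<alpha> t = \<bar>torsion \<gamma> t\<bar> powr (1 / beta CARD('n) \<alpha>)"

definition weighted_interval :: "(real \<Rightarrow> real) \<Rightarrow> real measure" where
  "weighted_interval w = density (lebesgue_on {0..1}) (\<lambda>t. ennreal (w t))"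

definition T :: "(real \<Rightarrow> real ^ 'n) \<Rightarrow> real \<Rightarrow> (real \<Rightarrow> complex) \<Rightarrow> real ^ 'n \<Rightarrow> complex" where
  "T \<gamma> lam f x =
     (LINT t | lebesgue_on {0..1}. exp (\<i> * complex_of_real (lam * (x \<bullet> \<gamma> t))) * f t)"

definition Tw :: "(real \<Rightarrow> real ^ 'n) \<Rightarrow> real \<Rightarrow> (real \<Rightarrow> real) \<Rightarrow> (real \<Rightarrow> complex)
    \<Rightarrow> real ^ 'n \<Rightarrow> complex" where
  "Tw \<gamma> lam w f x =
     (LINT t | lebesgue_on {0..1}.
        exp (\<i> * complex_of_real (lam * (x \<bullet> \<gamma> t))) * f t * complex_of_real (w t))"

end

theory Submission
  imports Defs
begin

text \<open>
  Finite type forces the torsion to be nonzero at some interior point \<open>t0\<close>: otherwise, near a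
  suitable point, all derivatives of \<open>\<gamma>\<close> stay in the span of fewer than \<open>d\<close> of them. Coordinates dual
  to the basis \<open>\<gamma>'(t0), \<dots>, \<gamma>\<^sup>(\<^sup>d\<^sup>)(t0)\<close> carry the measure \<open>\<mu>\<close>: a product of a point mass in
  the first \<open>j\<close> coordinates, the density \<open>y powr (\<theta> - 1)\<close> with \<open>\<theta> = \<alpha> - (d - j - 1)\<close> in the next one
  and Lebesgue measure in the rest, each on the half-line \<open>y > 0\<close>. The test function is the inverse
  weight on \<open>[t0, t0 + \<epsilon>]\<close>. Already for \<open>\<lambda> = 1\<close> its transform has modulus at least \<open>\<epsilon> / 2\<close> on the box
  where the \<open>k\<close>-th coordinate is at most \<open>c \<epsilon>\<^sup>-\<^sup>k\<close>, and this box has measure comparable to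
  \<open>\<epsilon> powr (- \<beta>)\<close>. Letting \<open>\<epsilon>\<close> tend to zero gives the relation between the exponents.
\<close>

section \<open>Independence of derivatives\<close>

text \<open>Functionals dual to the family recover each coefficient, so their operator norms control
  the coefficients. Unlike bare independence, such a bound visibly survives small
  perturbations.\<close>

lemma independent_coefficient_bound:
  fixes b :: "'i \<Rightarrow> 'a::euclidean_space"
  assumes "finite I" "inj_on b I" "independent (b ` I)"
  shows "\<exists>\<kappa>>0. \<forall>c. \<kappa> * (\<Sum>i\<in>I. \<bar>c i\<bar>) \<le> norm (\<Sum>i\<in>I. c i *\<^sub>R b i)"
proof -
  have "\<exists>g. linear g \<and> (\<forall>j\<in>I. g (b j) = (if j = i then 1 else 0::real))" if "i \<in> I" for i
  proof -
    obtain g :: "'a \<Rightarrow> real" where "linear g" "\<forall>x\<in>b ` I. g x = (if x = b i then 1 else 0)"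
      using linear_independent_extend[OF assms(3), of "\<lambda>x. if x = b i then 1 else 0::real"] by blast
    with that assms(2) show ?thesis
      by (intro exI[of _ g]) (auto simp: inj_on_eq_iff)
  qed
  then obtain g :: "'i \<Rightarrow> 'a \<Rightarrow> real" where lin: "\<And>i. i \<in> I \<Longrightarrow> linear (g i)"
    and dual: "\<And>i j. i \<in> I \<Longrightarrow> j \<in> I \<Longrightarrow> g i (b j) = (if j = i then 1 else 0)"
    by metis
  have coef: "g i (\<Sum>j\<in>I. c j *\<^sub>R b j) = c i" if "i \<in> I" for c i
  proof -
    have "g i (\<Sum>j\<in>I. c j *\<^sub>R b j) = (\<Sum>j\<in>I. c j * g i (b j))"
      using lin[OF that] by (simp add: linear_sum linear_cmul)
    also have "\<dots> = (\<Sum>j\<in>I. if j = i then c j else 0)"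
      using dual that by (intro sum.cong) auto
    finally show ?thesis
      using assms(1) that by simp
  qed
  \<comment> \<open>The summand \<open>1\<close> keeps \<open>K\<close> positive even for an empty
    family.\<close>
  define K where "K = 1 + (\<Sum>i\<in>I. onorm (g i))"
  have bl: "bounded_linear (g i)" if "i \<in> I" for i
    using lin[OF that] by (simp add: linear_conv_bounded_linear)
  have K: "K > 0"
    unfolding K_def using bl by (intro add_pos_nonneg sum_nonneg) (auto intro: onorm_pos_le)
  have "(\<Sum>i\<in>I. \<bar>c i\<bar>) \<le> K * norm (\<Sum>i\<in>I. c i *\<^sub>R b i)" for c
  proof -
    have "(\<Sum>i\<in>I. \<bar>c i\<bar>) \<le> (\<Sum>i\<in>I. onorm (g i) * norm (\<Sum>i\<in>I. c i *\<^sub>R b i))"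
      using onorm[OF bl] coef by (intro sum_mono) (metis real_norm_def)
    also have "\<dots> \<le> K * norm (\<Sum>i\<in>I. c i *\<^sub>R b i)"
      by (simp add: K_def sum_distrib_right distrib_right)
    finally show ?thesis .
  qed
  with K show ?thesis
    by (intro exI[of _ "1 / K"]) (auto simp: field_simps)
qed

text \<open>If each vector moves by less than \<open>\<kappa> / 2\<close>, the combination loses at
  most half of the lower bound. The filter is general because both punctured and full neighbourhoods
  occur below.\<close>

lemma independent_coefficient_bound_eventually:
  fixes v :: "'i \<Rightarrow> 'b \<Rightarrow> 'a::euclidean_space"
  assumes "finite I" "inj_on b I" "independent (b ` I)"
    and lim: "\<And>i. i \<in> I \<Longrightarrow> (v i \<longlongrightarrow> b i) F"
  shows "\<exists>\<kappa>>0. \<forall>\<^sub>F s in F. \<forall>c. \<kappa> * (\<Sum>i\<in>I. \<bar>c i\<bar>) \<le> norm (\<Sum>i\<in>I. c i *\<^sub>R v i s)"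
proof -
  obtain \<kappa> where \<kappa>: "\<kappa> > 0"
    and lower: "\<And>c. \<kappa> * (\<Sum>i\<in>I. \<bar>c i\<bar>) \<le> norm (\<Sum>i\<in>I. c i *\<^sub>R b i)"
    using independent_coefficient_bound[OF assms(1-3)] by blast
  have "\<forall>\<^sub>F s in F. \<forall>i\<in>I. dist (v i s) (b i) < \<kappa> / 2"
    using \<kappa> lim assms(1) by (intro eventually_ball_finite ballI tendstoD) auto
  then have "\<forall>\<^sub>F s in F. \<forall>c. \<kappa> / 2 * (\<Sum>i\<in>I. \<bar>c i\<bar>) \<le> norm (\<Sum>i\<in>I. c i *\<^sub>R v i s)"
  proof (eventually_elim, intro allI)
    fix s c assume near: "\<forall>i\<in>I. dist (v i s) (b i) < \<kappa> / 2"
    have "norm (\<Sum>i\<in>I. c i *\<^sub>R (b i - v i s)) \<le> (\<Sum>i\<in>I. \<bar>c i\<bar> * (\<kappa> / 2))"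
    proof (intro order_trans[OF norm_sum] sum_mono)
      fix i assume "i \<in> I"
      with near have "norm (b i - v i s) \<le> \<kappa> / 2"
        by (metis dist_norm dist_commute less_imp_le)
      then show "norm (c i *\<^sub>R (b i - v i s)) \<le> \<bar>c i\<bar> * (\<kappa> / 2)"
        by (simp only: norm_scaleR mult_left_mono abs_ge_zero)
    qed
    moreover have "norm (\<Sum>i\<in>I. c i *\<^sub>R b i)
        \<le> norm (\<Sum>i\<in>I. c i *\<^sub>R v i s) + norm (\<Sum>i\<in>I. c i *\<^sub>R (b i - v i s))"
      using norm_triangle_ineq[of "\<Sum>i\<in>I. c i *\<^sub>R v i s" "\<Sum>i\<in>I. c i *\<^sub>R (b i - v i s)"]
      by (simp add: sum.distrib[symmetric] scaleR_diff_right)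
    ultimately show "\<kappa> / 2 * (\<Sum>i\<in>I. \<bar>c i\<bar>) \<le> norm (\<Sum>i\<in>I. c i *\<^sub>R v i s)"
      using lower[of c] unfolding sum_distrib_right[symmetric] by (simp add: algebra_simps)
  qed
  with \<kappa> show ?thesis by (intro exI[of _ "\<kappa> / 2"]) auto
qed

text \<open>Turns the quantitative bound back into independence at nearby points. Injectivity is
  stated separately because a family with repetitions can still have an independent image.\<close>

lemma coefficient_bound_imp_independent:
  fixes b :: "'i \<Rightarrow> 'a::real_normed_vector"
  assumes "finite I" "\<kappa> > 0"
    and lower: "\<And>c. \<kappa> * (\<Sum>i\<in>I. \<bar>c i\<bar>) \<le> norm (\<Sum>i\<in>I. c i *\<^sub>R b i)"
  shows "inj_on b I" "independent (b ` I)"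
proof -
  have zero: "c i = 0" if "(\<Sum>i\<in>I. c i *\<^sub>R b i) = 0" "i \<in> I" for c i
  proof -
    have "(\<Sum>i\<in>I. \<bar>c i\<bar>) \<le> 0"
      using lower[of c] that assms(2) by (simp add: mult_le_0_iff)
    then have "(\<Sum>i\<in>I. \<bar>c i\<bar>) = 0"
      by (meson abs_ge_zero antisym sum_nonneg)
    with that assms(1) show ?thesis
      by (simp add: sum_nonneg_eq_0_iff)
  qed
  show inj: "inj_on b I"
  proof (rule inj_onI, rule ccontr)
    fix x y assume xy: "x \<in> I" "y \<in> I" "b x = b y" "x \<noteq> y"
    \<comment> \<open>These coefficients produce \<open>b x - b y\<close>, which is zero.\<close>
    define c where "c i = (if i = x then 1 else 0) - (if i = y then 1 else 0::real)" for i
    have "(\<Sum>i\<in>I. c i *\<^sub>R b i) = (\<Sum>i\<in>I. if i = x then b i else 0) - (\<Sum>i\<in>I. if i = y then b i else 0)"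
      unfolding c_def sum_subtractf[symmetric] by (intro sum.cong) auto
    with xy assms(1) have "(\<Sum>i\<in>I. c i *\<^sub>R b i) = 0"
      by simp
    from zero[OF this xy(1)] xy show False by (simp add: c_def)
  qed
  show "independent (b ` I)"
  proof (rule independent_if_scalars_zero)
    show "finite (b ` I)" using assms(1) by simp
    fix f x assume *: "(\<Sum>x\<in>b ` I. f x *\<^sub>R x) = 0" "x \<in> b ` I"
    then have "(\<Sum>i\<in>I. f (b i) *\<^sub>R b i) = 0"
      using inj by (simp add: sum.reindex)
    from zero[of "\<lambda>i. f (b i)", OF this] * show "f x = 0" by auto
  qed
qed

text \<open>The coefficients of \<open>y s\<close> need not be differentiable in \<open>s\<close>; it suffices that they stay bounded
  as \<open>s\<close> tends to \<open>t\<close>, since a functional that vanishes on \<open>V t\<close> maps each \<open>v i s\<close> to \<open>o(s - t)\<close>.\<close>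

lemma vector_derivative_in_moving_span:
  fixes v :: "'i \<Rightarrow> real \<Rightarrow> 'a::euclidean_space" and I :: "'i set"
  defines "V \<equiv> \<lambda>s. span ((\<lambda>i. v i s) ` I)"
  assumes fin: "finite I" and inj: "inj_on (\<lambda>i. v i t) I"
    and ind: "independent ((\<lambda>i. v i t) ` I)"
    and dv: "\<And>i. i \<in> I \<Longrightarrow> (v i has_vector_derivative v' i) (at t)"
    and v': "\<And>i. i \<in> I \<Longrightarrow> v' i \<in> V t"
    and dy: "(y has_vector_derivative y') (at t)"
    and yV: "\<forall>\<^sub>F s in at t. y s \<in> V s" and yt: "y t \<in> V t"
  shows "y' \<in> V t"
proof (rule ccontr)
  assume "y' \<notin> V t"
  then have notin: "y' \<notin> (\<lambda>i. v i t) ` I" and ind': "independent (insert y' ((\<lambda>i. v i t) ` I))"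
    unfolding V_def using ind by (blast intro: span_base, intro independent_insertI)
  \<comment> \<open>A functional that vanishes on \<open>V t\<close> and is 1 at \<open>y'\<close>;
    the contradiction will be \<open>g y' = 0\<close>.\<close>
  obtain g :: "'a \<Rightarrow> real" where lin: "linear g"
    and g: "\<forall>x\<in>insert y' ((\<lambda>i. v i t) ` I). g x = (if x = y' then 1 else 0)"
    using linear_independent_extend[OF ind', of "\<lambda>x. if x = y' then 1 else 0::real"] by blast
  have gv: "g (v i t) = 0" if "i \<in> I" for i
    using g notin that by auto
  have gV: "g x = 0" if "x \<in> V t" for x
    using linear_eq_0_on_span[OF lin _ that[unfolded V_def]] gv by auto
  have bl: "bounded_linear g"
    using lin by (simp add: linear_conv_bounded_linear)
  have quot: "((\<lambda>s. g (z s) / (s - t)) \<longlongrightarrow> g z') (at t)"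
    if "(z has_vector_derivative z') (at t)" "z t \<in> V t" for z z'
  proof -
    have "((\<lambda>s. g (z s)) has_vector_derivative g z') (at t)"
      by (rule bounded_linear.has_vector_derivative[OF bl that(1)])
    then show ?thesis
      using gV[OF that(2)]
      by (simp add: has_real_derivative_iff_has_vector_derivative[symmetric] has_field_derivative_iff)
  qed
  have cont: "(z \<longlongrightarrow> z t) (at t)" if "(z has_vector_derivative z') (at t)" for z :: "real \<Rightarrow> 'a" and z'
    using has_vector_derivative_continuous[OF that] by (simp add: isCont_def)
  obtain \<kappa> where \<kappa>: "\<kappa> > 0"
    and lower: "\<forall>\<^sub>F s in at t. \<forall>c. \<kappa> * (\<Sum>i\<in>I. \<bar>c i\<bar>) \<le> norm (\<Sum>i\<in>I. c i *\<^sub>R v i s)"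
    using independent_coefficient_bound_eventually[OF fin inj ind, of v "at t"] cont dv by blast
  have inj': "\<forall>\<^sub>F s in at t. inj_on (\<lambda>i. v i s) I"
    using lower by eventually_elim (rule coefficient_bound_imp_independent(1)[OF fin \<kappa>], blast)
  \<comment> \<open>The factor \<open>norm (y s) / \<kappa>\<close> bounds every coefficient of
    \<open>y s\<close> and has a finite limit, while the quotients tend to
    \<open>g (v' i) = 0\<close>.\<close>
  define h where "h s = norm (y s) / \<kappa> * (\<Sum>i\<in>I. \<bar>g (v i s) / (s - t)\<bar>)" for s
  have bound: "\<forall>\<^sub>F s in at t. norm (g (y s) / (s - t)) \<le> h s"
    using lower yV inj'
  proof eventually_elim
    case (elim s)
    obtain u where "y s = (\<Sum>x\<in>(\<lambda>i. v i s) ` I. u x *\<^sub>R x)"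
      using elim(2) fin by (auto simp: V_def span_finite)
    then have y: "y s = (\<Sum>i\<in>I. u (v i s) *\<^sub>R v i s)"
      using elim(3) by (simp add: sum.reindex)
    define c where "c i = u (v i s)" for i
    have csum: "(\<Sum>i\<in>I. \<bar>c i\<bar>) \<le> norm (y s) / \<kappa>"
      using elim(1)[rule_format, of c] \<kappa> y by (simp add: c_def field_simps)
    have "g (y s) / (s - t) = (\<Sum>i\<in>I. c i * (g (v i s) / (s - t)))"
      unfolding y using lin by (simp add: linear_sum linear_cmul c_def sum_divide_distrib)
    also have "norm \<dots> \<le> (\<Sum>i\<in>I. \<bar>c i\<bar> * \<bar>g (v i s) / (s - t)\<bar>)"
      by (intro order_trans[OF norm_sum] sum_mono) (simp add: abs_mult)
    also have "\<dots> \<le> (\<Sum>i\<in>I. norm (y s) / \<kappa> * \<bar>g (v i s) / (s - t)\<bar>)"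
    proof (intro sum_mono mult_right_mono)
      fix i assume "i \<in> I"
      then have "\<bar>c i\<bar> \<le> (\<Sum>i\<in>I. \<bar>c i\<bar>)"
        using fin by (intro member_le_sum) auto
      with csum show "\<bar>c i\<bar> \<le> norm (y s) / \<kappa>" by linarith
    qed auto
    finally show ?case by (simp add: h_def sum_distrib_left)
  qed
  have "(h \<longlongrightarrow> norm (y t) / \<kappa> * (\<Sum>i\<in>I. \<bar>g (v' i)\<bar>)) (at t)"
    unfolding h_def using \<kappa>
    by (intro tendsto_mult tendsto_divide tendsto_norm tendsto_const tendsto_sum tendsto_rabs
        quot dv cont[OF dy]) (auto simp: V_def intro: span_base)
  moreover have "(\<Sum>i\<in>I. \<bar>g (v' i)\<bar>) = 0"
    using gV v' by simp
  ultimately have "(h \<longlongrightarrow> 0) (at t)" by simp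
  with bound have "((\<lambda>s. g (y s) / (s - t)) \<longlongrightarrow> 0) (at t)"
    by (rule Lim_null_comparison)
  with quot[OF dy yt] have "g y' = 0"
    using tendsto_unique trivial_limit_at by blast
  with g show False by simp
qed

text \<open>Let \<open>r\<close> be the largest number such that \<open>v 0, \<dots>, v (r - 1)\<close> are independent somewhere in
  \<open>U\<close>. Near such a point \<open>v r\<close> lies in their span, which is therefore closed under differentiation.\<close>

lemma derivatives_in_span_of_initial_independent:
  fixes v :: "nat \<Rightarrow> real \<Rightarrow> 'a::euclidean_space"
  assumes "open U" "U \<noteq> {}"
    and dv: "\<And>k t. t \<in> U \<Longrightarrow> (v k has_vector_derivative v (Suc k) t) (at t)"
  shows "\<exists>t\<in>U. \<exists>r. inj_on (\<lambda>k. v k t) {..<r} \<and> independent ((\<lambda>k. v k t) ` {..<r})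
           \<and> (\<forall>k. v k t \<in> span ((\<lambda>k. v k t) ` {..<r}))"
proof -
  define ind where
    "ind r t \<longleftrightarrow> inj_on (\<lambda>k. v k t) {..<r} \<and> independent ((\<lambda>k. v k t) ` {..<r})" for r t
  define V where "V r t = span ((\<lambda>k. v k t) ` {..<r})" for r t
  have "\<not> ind (Suc DIM('a)) t" for t
    using independent_bound[of "(\<lambda>k. v k t) ` {..<Suc DIM('a)}"]
      card_image[of "\<lambda>k. v k t" "{..<Suc DIM('a)}"] unfolding ind_def by simp linarith
  then have ex: "\<exists>n. \<forall>t\<in>U. \<not> ind n t" by blast
  \<comment> \<open>The first length at which independence fails throughout \<open>U\<close>. It
    exists by dimension and is positive because the empty family is independent.\<close>
  define n where "n = (LEAST n. \<forall>t\<in>U. \<not> ind n t)"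
  have n: "\<forall>t\<in>U. \<not> ind n t"
    unfolding n_def by (rule LeastI_ex[OF ex])
  have "n \<noteq> 0"
    using n assms(2) by (auto simp: ind_def independent_empty)
  then obtain r where r: "n = Suc r" using not0_implies_Suc by blast
  have "\<not> (\<forall>t\<in>U. \<not> ind r t)"
    using not_less_Least[of r "\<lambda>n. \<forall>t\<in>U. \<not> ind n t"] r by (simp add: n_def[symmetric])
  then obtain t where t: "t \<in> U" "ind r t" by blast
  \<comment> \<open>Otherwise \<open>v r s\<close> would extend the independent family to length
    \<open>n\<close>.\<close>
  have step: "v r s \<in> V r s" if "s \<in> U" "ind r s" for s
  proof (rule ccontr)
    assume *: "v r s \<notin> V r s"
    then have "v r s \<notin> (\<lambda>k. v k s) ` {..<r}"
      unfolding V_def by (blast intro: span_base)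
    with * that(2) have "ind (Suc r) s"
      by (simp add: ind_def lessThan_Suc V_def independent_insertI)
    with n that(1) r show False by blast
  qed
  obtain \<kappa> where \<kappa>: "\<kappa> > 0"
    and lower: "\<forall>\<^sub>F s in nhds t. \<forall>c. \<kappa> * (\<Sum>i<r. \<bar>c i\<bar>) \<le> norm (\<Sum>i<r. c i *\<^sub>R v i s)"
  proof -
    have "(v i \<longlongrightarrow> v i t) (nhds t)" for i
      using has_vector_derivative_continuous[OF dv[OF t(1)]] by (simp add: isCont_def tendsto_at_iff_tendsto_nhds)
    then show ?thesis
      using independent_coefficient_bound_eventually[of "{..<r}" "\<lambda>k. v k t" v "nhds t"] t(2) that
      unfolding ind_def by blast
  qed
  have "\<forall>\<^sub>F s in nhds t. s \<in> U \<and> ind r s"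
    using lower eventually_nhds_in_open[OF assms(1) t(1)]
  proof eventually_elim
    case (elim s)
    then show ?case
      using coefficient_bound_imp_independent[OF finite_lessThan \<kappa>, of r "\<lambda>k. v k s"]
      by (simp add: ind_def)
  qed
  then obtain W where W: "open W" "t \<in> W" "\<And>s. s \<in> W \<Longrightarrow> s \<in> U \<and> ind r s"
    unfolding eventually_nhds by blast
  \<comment> \<open>Differentiating a spanning vector raises its index by one, and
    \<open>step\<close> covers the index \<open>r\<close> reached this way. Openness of
    \<open>W\<close> gives membership on a whole neighbourhood, as the moving-span lemma
    requires.\<close>
  have all: "\<forall>s\<in>W. v k s \<in> V r s" for k
  proof (induction k)
    case 0
    show ?case
      using step W(3) by (cases "r = 0") (auto simp: V_def intro: span_base)
  next
    case (Suc k)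
    show ?case
    proof
      fix s assume s: "s \<in> W"
      have "\<forall>\<^sub>F x in at s. x \<in> W"
        using eventually_at_in_open'[OF W(1) s] .
      then have ev: "\<forall>\<^sub>F x in at s. v k x \<in> V r x"
        by eventually_elim (use Suc in blast)
      have shift: "v (Suc i) s \<in> V r s" if "i < r" for i
        using that step W(3)[OF s] by (cases "Suc i = r") (auto simp: V_def intro: span_base)
      show "v (Suc k) s \<in> V r s"
        unfolding V_def
      proof (rule vector_derivative_in_moving_span)
        show "finite {..<r}" by simp
        show "inj_on (\<lambda>k. v k s) {..<r}" "independent ((\<lambda>k. v k s) ` {..<r})"
          using W(3)[OF s] by (simp_all add: ind_def)
        show "(v i has_vector_derivative v (Suc i) s) (at s)" for i
          using dv W(3)[OF s] by blast
        then show "(v k has_vector_derivative v (Suc k) s) (at s)" .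
        show "v (Suc i) s \<in> span ((\<lambda>i. v i s) ` {..<r})" if "i \<in> {..<r}" for i
          using shift that by (simp add: V_def)
        show "\<forall>\<^sub>F x in at s. v k x \<in> span ((\<lambda>i. v i x) ` {..<r})"
          using ev by (simp add: V_def)
        show "v k s \<in> span ((\<lambda>i. v i s) ` {..<r})"
          using Suc s by (simp add: V_def)
      qed
    qed
  qed
  show ?thesis
    using t all W(2) unfolding ind_def V_def by blast
qed

section \<open>Measures with anisotropic growth\<close>

text \<open>For \<open>\<theta> > 0\<close> the density \<open>y powr (\<theta> - 1)\<close> on the
  half-line does not increase, so intervals far from 0 gain nothing. For \<open>\<theta> = 0\<close>
  that density is not integrable at 0 and a point mass replaces it.\<close>

lemma power_growth_measure:
  assumes "0 \<le> \<theta>" "\<theta> \<le> 1"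
  shows "\<exists>N :: real measure. sets N = sets borel \<and> sigma_finite_measure N
     \<and> (\<exists>C>0. \<forall>a. \<forall>r>0. emeasure N {a - r..a + r} \<le> ennreal (C * r powr \<theta>))
     \<and> (\<exists>c>0. \<forall>r>0. ennreal (c * r powr \<theta>) \<le> emeasure N {- r..r})"
proof (cases "\<theta> = 0")
  case True
  have "sigma_finite_measure (return borel (0::real))"
    by (intro prob_space_imp_sigma_finite prob_space_return) simp
  with True show ?thesis
    by (intro exI[of _ "return borel 0"] conjI exI[of _ 1]) (auto simp: indicator_def)
next
  case False
  with assms have pos: "0 < \<theta>" by simp
  define \<phi> where "\<phi> y = indicator {0..} y * y powr (\<theta> - 1)" for y :: real
  define N where "N = density lborel (\<lambda>y. ennreal (\<phi> y))"
  have meas [measurable]: "\<phi> \<in> borel_measurable borel"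
    unfolding \<phi>_def by measurable
  have nonneg: "\<phi> y \<ge> 0" for y
    by (simp add: \<phi>_def)
  have em: "emeasure N A = (\<integral>\<^sup>+y. ennreal (\<phi> y) * indicator A y \<partial>lborel)" if "A \<in> sets borel" for A
    using that by (simp add: N_def emeasure_density)
  have central: "emeasure N {- r..r} = ennreal (r powr \<theta> / \<theta>)" if "r > 0" for r
  proof -
    have "((\<lambda>y. y powr (\<theta> - 1)) has_integral r powr \<theta> / \<theta>) {0..r}"
      using has_integral_powr_from_0[of "\<theta> - 1" r] pos that by simp
    then have "((\<lambda>y. if y \<in> {0..r} then y powr (\<theta> - 1) else 0) has_integral r powr \<theta> / \<theta>) UNIV"
      by (simp only: has_integral_restrict_UNIV)
    then have "(\<integral>\<^sup>+y. ennreal (if y \<in> {0..r} then y powr (\<theta> - 1) else 0) \<partial>lborel)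
        = ennreal (r powr \<theta> / \<theta>)"
      by (intro nn_integral_has_integral_lborel) auto
    moreover have "emeasure N {- r..r}
        = (\<integral>\<^sup>+y. ennreal (if y \<in> {0..r} then y powr (\<theta> - 1) else 0) \<partial>lborel)"
      using that by (subst em) (auto intro!: nn_integral_cong simp: \<phi>_def indicator_def)
    ultimately show ?thesis by simp
  qed
  have upper: "emeasure N {a - r..a + r} \<le> ennreal (max (3 powr \<theta> / \<theta>) 2 * r powr \<theta>)"
    if r: "r > 0" for a r
  \<comment> \<open>Near the origin the interval fits into the central one of radius
    \<open>3 * r\<close>. Otherwise its nonnegative points all exceed \<open>r\<close>, where the
    density is at most \<open>r powr (\<theta> - 1)\<close>.\<close>
  proof (cases "\<bar>a\<bar> \<le> 2 * r")
    case True
    have "emeasure N {a - r..a + r} \<le> emeasure N {- (3 * r)..3 * r}"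
      using True by (intro emeasure_mono) (auto simp: N_def)
    also have "\<dots> = ennreal (3 powr \<theta> / \<theta> * r powr \<theta>)"
      using r by (subst central) (auto simp: powr_mult)
    also have "\<dots> \<le> ennreal (max (3 powr \<theta> / \<theta>) 2 * r powr \<theta>)"
      by (intro ennreal_leI mult_right_mono) auto
    finally show ?thesis .
  next
    case False
    have "emeasure N {a - r..a + r}
        \<le> (\<integral>\<^sup>+y. ennreal (r powr (\<theta> - 1)) * indicator {a - r..a + r} y \<partial>lborel)"
    proof (subst em, simp, intro nn_integral_mono)
      fix y
      have "\<phi> y \<le> r powr (\<theta> - 1)" if "y \<in> {a - r..a + r}"
      proof (cases "y \<ge> 0")
        case True
        with that False r have "r \<le> y" by auto
        with r assms show ?thesis
          by (simp add: \<phi>_def powr_mono2')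
      qed (simp add: \<phi>_def)
      then show "ennreal (\<phi> y) * indicator {a - r..a + r} y
          \<le> ennreal (r powr (\<theta> - 1)) * indicator {a - r..a + r} y"
        by (auto simp: indicator_def intro: ennreal_leI)
    qed
    also have "\<dots> = ennreal (r powr (\<theta> - 1) * (2 * r))"
      using r by (simp add: nn_integral_cmult ennreal_mult)
    also have "r powr (\<theta> - 1) * (2 * r) = 2 * r powr \<theta>"
      using r by (simp add: powr_diff)
    also have "ennreal (2 * r powr \<theta>) \<le> ennreal (max (3 powr \<theta> / \<theta>) 2 * r powr \<theta>)"
      by (intro ennreal_leI mult_right_mono) auto
    finally show ?thesis .
  qed
  have "sigma_finite_measure N"
    unfolding N_def
    by (subst sigma_finite_measure.sigma_finite_iff_density_finite[OF sigma_finite_lborel]) auto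
  moreover have "sets N = sets borel" by (simp add: N_def)
  moreover have "max (3 powr \<theta> / \<theta>) 2 > 0" "1 / \<theta> > 0" using pos by auto
  ultimately show ?thesis
    using upper central
    by (intro exI[of _ N] conjI exI[of _ "max (3 powr \<theta> / \<theta>) 2"] exI[of _ "1 / \<theta>"]) auto
qed

section \<open>Product measures in linear coordinates\<close>

text \<open>\<open>B\<close> inverts the matrix with rows \<open>v i\<close>, so its columns form
  the dual basis. The first property serves to transport a product measure, the second to bound a
  vector by its coordinates.\<close>

lemma invertible_coordinates:
  fixes v :: "'n \<Rightarrow> real ^ 'n"
  assumes "det (\<chi> i j. v j $ i) \<noteq> 0"
  obtains B :: "real ^ 'n ^ 'n"
  where "\<And>z i. (B *v z) \<bullet> v i = z $ i" "\<And>x. x = B *v (\<chi> i. x \<bullet> v i)"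
proof -
  define A :: "real ^ 'n ^ 'n" where "A = (\<chi> i. v i)"
  have "transpose A = (\<chi> i j. v j $ i)"
    by (simp add: A_def transpose_def)
  with assms have "det A \<noteq> 0"
    by (metis det_transpose)
  then obtain B where B: "A ** B = mat 1" "B ** A = mat 1"
    by (auto simp: invertible_det_nz[symmetric] invertible_def)
  have A: "A *v x = (\<chi> i. x \<bullet> v i)" for x
    by (simp add: A_def matrix_vector_mult_def inner_vec_def mult.commute)
  show thesis
  proof
    show "(B *v z) \<bullet> v i = z $ i" for z i
      using arg_cong[OF A[of "B *v z"], of "\<lambda>y. y $ i"] B(1)
      by (simp add: matrix_vector_mul_assoc)
    show "x = B *v (\<chi> i. x \<bullet> v i)" for x
      using B(2) A[of x] by (metis matrix_vector_mul_assoc matrix_vector_mul_lid)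
  qed
qed

text \<open>In the coordinates \<open>x \<bullet> v i\<close> the measure is a product. A ball lies
  in a cube of comparable size, so the exponents add up, whereas a box with unrelated side lengths
  keeps a separate power for each side.\<close>

lemma anisotropic_growth_measure:
  fixes v :: "'n \<Rightarrow> real ^ 'n" and \<theta> :: "'n \<Rightarrow> real"
  assumes det: "det (\<chi> i j. v j $ i) \<noteq> 0" and \<theta>: "\<And>i. 0 \<le> \<theta> i" "\<And>i. \<theta> i \<le> 1"
  shows "\<exists>\<mu> :: (real ^ 'n) measure. sets \<mu> = sets borel
     \<and> (\<exists>C. \<forall>x. \<forall>\<rho>>0. emeasure \<mu> (ball x \<rho>) \<le> ennreal (C * \<rho> powr (\<Sum>i\<in>UNIV. \<theta> i)))
     \<and> (\<exists>c>0. \<forall>r. (\<forall>i. r i > 0) \<longrightarrow>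
          ennreal (c * (\<Prod>i\<in>UNIV. r i powr \<theta> i)) \<le> emeasure \<mu> {x. \<forall>i. \<bar>x \<bullet> v i\<bar> \<le> r i})"
proof -
  obtain B :: "real ^ 'n ^ 'n" where B: "\<And>z i. (B *v z) \<bullet> v i = z $ i"
    using invertible_coordinates[OF det] by metis
  have "\<exists>N C c. sets N = sets (borel :: real measure) \<and> sigma_finite_measure N \<and> 0 < C \<and> 0 < c
     \<and> (\<forall>a. \<forall>r>0. emeasure N {a - r..a + r} \<le> ennreal (C * r powr \<theta> i))
     \<and> (\<forall>r>0. ennreal (c * r powr \<theta> i) \<le> emeasure N {- r..r})" for i
    using power_growth_measure[OF \<theta>, of i] by blast
  then obtain N :: "'n \<Rightarrow> real measure" and C c where
    sets [measurable_cong]: "\<And>i. sets (N i) = sets borel"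
    and sf: "\<And>i. sigma_finite_measure (N i)"
    and C: "\<And>i. C i > 0" "\<And>i a r. r > 0 \<Longrightarrow> emeasure (N i) {a - r..a + r} \<le> ennreal (C i * r powr \<theta> i)"
    and c: "\<And>i. c i > 0" "\<And>i r. r > 0 \<Longrightarrow> ennreal (c i * r powr \<theta> i) \<le> emeasure (N i) {- r..r}"
    by metis
  interpret product_sigma_finite N
    using sf by (simp add: product_sigma_finite_def)
  define L :: "('n \<Rightarrow> real) \<Rightarrow> real ^ 'n" where "L z = B *v (\<chi> i. z i)" for z
  define \<mu> where "\<mu> = distr (Pi\<^sub>M UNIV N) borel L"
  have sp: "space (Pi\<^sub>M UNIV N) = UNIV"
    using sets sets_eq_imp_space_eq[OF sets] by (auto simp: space_PiM PiE_def extensional_def)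
  have [measurable]: "L \<in> borel_measurable (Pi\<^sub>M UNIV N)"
    unfolding L_def matrix_vector_mult_def
    by (subst borel_measurable_euclidean_space) (auto simp: Basis_vec_def inner_axis)
  have L: "L z \<bullet> v i = z i" for z i
    by (simp add: L_def B)
  have box: "emeasure (Pi\<^sub>M UNIV N) {z. \<forall>i. z i \<in> {a i - r i..a i + r i}}
      = (\<Prod>i\<in>UNIV. emeasure (N i) {a i - r i..a i + r i})" for a r :: "'n \<Rightarrow> real"
    using emeasure_PiM[of UNIV "\<lambda>i. {a i - r i..a i + r i}"] sets by (simp add: PiE_def Pi_def)
  show ?thesis
  proof (intro exI[of _ \<mu>] conjI)
    show "sets \<mu> = sets borel" by (simp add: \<mu>_def)
    define M where "M = 1 + (\<Sum>i\<in>UNIV. norm (v i))"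
    have M: "M > 0" "norm (v i) \<le> M" for i
    proof -
      show "M > 0" unfolding M_def by (intro add_pos_nonneg sum_nonneg) auto
      have "norm (v i) \<le> (\<Sum>i\<in>UNIV. norm (v i))" by (intro member_le_sum) auto
      then show "norm (v i) \<le> M" by (simp add: M_def)
    qed
    show "\<exists>C. \<forall>x. \<forall>\<rho>>0. emeasure \<mu> (ball x \<rho>) \<le> ennreal (C * \<rho> powr (\<Sum>i\<in>UNIV. \<theta> i))"
    proof (intro exI[of _ "\<Prod>i\<in>UNIV. C i * M powr \<theta> i"] allI impI)
      fix x :: "real ^ 'n" and \<rho> :: real assume \<rho>: "\<rho> > 0"
      \<comment> \<open>By Cauchy-Schwarz each coordinate varies by at most
        \<open>M * \<rho>\<close> over the ball.\<close>
      have sub: "L -` ball x \<rho> \<subseteq> {z. \<forall>i. z i \<in> {x \<bullet> v i - M * \<rho>..x \<bullet> v i + M * \<rho>}}"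
      proof safe
        fix z i assume "L z \<in> ball x \<rho>"
        then have "norm (L z - x) \<le> \<rho>"
          by (simp add: dist_norm norm_minus_commute)
        then have "norm (L z - x) * norm (v i) \<le> \<rho> * M"
          using M \<rho> by (intro mult_mono) auto
        then have "\<bar>(L z - x) \<bullet> v i\<bar> \<le> \<rho> * M"
          using Cauchy_Schwarz_ineq2[of "L z - x" "v i"] by linarith
        then have "\<bar>z i - x \<bullet> v i\<bar> \<le> M * \<rho>"
          by (simp add: inner_diff_left L mult.commute)
        then show "z i \<in> {x \<bullet> v i - M * \<rho>..x \<bullet> v i + M * \<rho>}" by auto
      qed
      have "emeasure \<mu> (ball x \<rho>) = emeasure (Pi\<^sub>M UNIV N) (L -` ball x \<rho>)"
        by (simp add: \<mu>_def emeasure_distr sp)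
      also have "\<dots> \<le> emeasure (Pi\<^sub>M UNIV N) {z. \<forall>i. z i \<in> {x \<bullet> v i - M * \<rho>..x \<bullet> v i + M * \<rho>}}"
      proof (rule emeasure_mono[OF sub])
        have "{z \<in> space (Pi\<^sub>M UNIV N). \<forall>i. z i \<in> {x \<bullet> v i - M * \<rho>..x \<bullet> v i + M * \<rho>}} \<in> sets (Pi\<^sub>M UNIV N)"
          by measurable
        then show "{z. \<forall>i. z i \<in> {x \<bullet> v i - M * \<rho>..x \<bullet> v i + M * \<rho>}} \<in> sets (Pi\<^sub>M UNIV N)"
          by (simp add: sp)
      qed
      also have "\<dots> = (\<Prod>i\<in>UNIV. emeasure (N i) {x \<bullet> v i - M * \<rho>..x \<bullet> v i + M * \<rho>})"
        by (rule box)
      also have "\<dots> \<le> (\<Prod>i\<in>UNIV. ennreal (C i * (M * \<rho>) powr \<theta> i))"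
        using C(2) M(1) \<rho> by (intro prod_mono_ennreal) simp
      also have "\<dots> = ennreal (\<Prod>i\<in>UNIV. C i * (M * \<rho>) powr \<theta> i)"
        using C(1) by (intro prod_ennreal) (simp add: less_imp_le)
      also have "(\<Prod>i\<in>UNIV. C i * (M * \<rho>) powr \<theta> i) = (\<Prod>i\<in>UNIV. C i * M powr \<theta> i) * \<rho> powr (\<Sum>i\<in>UNIV. \<theta> i)"
        using M(1) \<rho> by (simp add: powr_mult powr_sum prod.distrib)
      finally show "emeasure \<mu> (ball x \<rho>) \<le> ennreal ((\<Prod>i\<in>UNIV. C i * M powr \<theta> i) * \<rho> powr (\<Sum>i\<in>UNIV. \<theta> i))" .
    qed
    show "\<exists>c>0. \<forall>r. (\<forall>i. r i > 0) \<longrightarrow>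
          ennreal (c * (\<Prod>i\<in>UNIV. r i powr \<theta> i)) \<le> emeasure \<mu> {x. \<forall>i. \<bar>x \<bullet> v i\<bar> \<le> r i}"
    proof (intro exI[of _ "\<Prod>i\<in>UNIV. c i"] conjI allI impI)
      show "(\<Prod>i\<in>UNIV. c i) > 0" using c(1) by (intro prod_pos) auto
      fix r :: "'n \<Rightarrow> real" assume r: "\<forall>i. r i > 0"
      have "ennreal ((\<Prod>i\<in>UNIV. c i) * (\<Prod>i\<in>UNIV. r i powr \<theta> i)) = (\<Prod>i\<in>UNIV. ennreal (c i * r i powr \<theta> i))"
        using c(1) by (subst prod_ennreal) (simp_all add: less_imp_le prod.distrib)
      also have "\<dots> \<le> (\<Prod>i\<in>UNIV. emeasure (N i) {0 - r i..0 + r i})"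
        using c(2) r by (intro prod_mono_ennreal) simp
      also have "\<dots> = emeasure (Pi\<^sub>M UNIV N) {z. \<forall>i. z i \<in> {0 - r i..0 + r i}}"
        by (rule box[symmetric])
      also have "{z. \<forall>i. z i \<in> {0 - r i..0 + r i}} = L -` {x. \<forall>i. \<bar>x \<bullet> v i\<bar> \<le> r i}"
        by (auto simp: L abs_le_iff minus_le_iff)
      also have "emeasure (Pi\<^sub>M UNIV N) \<dots> = emeasure \<mu> {x. \<forall>i. \<bar>x \<bullet> v i\<bar> \<le> r i}"
        by (simp add: \<mu>_def emeasure_distr sp)
      finally show "ennreal ((\<Prod>i\<in>UNIV. c i) * (\<Prod>i\<in>UNIV. r i powr \<theta> i))
          \<le> emeasure \<mu> {x. \<forall>i. \<bar>x \<bullet> v i\<bar> \<le> r i}" .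
    qed
  qed
qed

section \<open>Curves of finite type\<close>

lemma nderiv_has_vector_derivative:
  assumes "smooth_curve \<gamma>" "t \<in> {0..1}"
  shows "(nderiv k \<gamma> has_vector_derivative nderiv (Suc k) \<gamma> t) (at t within {0..1})"
  using assms by (simp add: smooth_curve_def nderiv_def vector_derivative_works)

lemma nderiv_has_vector_derivative_interior:
  assumes "smooth_curve \<gamma>" "0 < t" "t < 1"
  shows "(nderiv k \<gamma> has_vector_derivative nderiv (Suc k) \<gamma> t) (at t)"
  using nderiv_has_vector_derivative[OF assms(1), of t k] assms(2,3)
  by (simp add: at_within_Icc_at)

lemma continuous_on_nderiv:
  assumes "smooth_curve \<gamma>"
  shows "continuous_on {0..1} (nderiv k \<gamma>)"
  using nderiv_has_vector_derivative[OF assms]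
  by (meson continuous_on_eq_continuous_within has_vector_derivative_continuous)

text \<open>The order, from 1 to d, of the derivative that \<open>torsion\<close> puts into column
  \<open>i\<close>; it carries data indexed by orders over to the unordered index type.\<close>

definition column_number :: "'n::finite \<Rightarrow> nat" where
  "column_number i = Suc (to_nat_on (UNIV :: 'n set) i)"

lemma bij_betw_column_number: "bij_betw column_number (UNIV :: 'n::finite set) {1..CARD('n)}"
proof -
  have "bij_betw (Suc \<circ> to_nat_on UNIV) (UNIV :: 'n set) (Suc ` {..<CARD('n)})"
    using to_nat_on_finite[of "UNIV :: 'n set"] by (intro bij_betw_trans[of _ _ "{..<CARD('n)}"]) (auto simp: bij_betw_def)
  then show ?thesis
    by (simp add: image_Suc_lessThan comp_def column_number_def[abs_def])
qed

lemma det_cols_eq: "det_cols v = det (\<chi> i j. v (column_number j) $ i)"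
  by (simp add: det_cols_def column_number_def)

lemma sum_column_number:
  "(\<Sum>i\<in>(UNIV :: 'n::finite set). f (column_number i)) = (\<Sum>k=1..CARD('n). f k)"
  using sum.reindex_bij_betw[OF bij_betw_column_number] .

lemma continuous_on_torsion:
  fixes \<gamma> :: "real \<Rightarrow> real ^ 'n"
  assumes "smooth_curve \<gamma>"
  shows "continuous_on {0..1} (torsion \<gamma>)"
  unfolding torsion_def[abs_def] det_cols_def det_def vec_lambda_beta
  by (rule continuous_on_sum, rule continuous_on_mult[OF continuous_on_const continuous_on_prod],
      rule continuous_on_component[OF continuous_on_nderiv[OF assms]])

text \<open>Through spans, determinants built from different families of derivatives can be compared
  without being computed.\<close>

lemma det_nonzero_iff_span_columns:
  fixes w :: "'n \<Rightarrow> real ^ 'n"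
  shows "det (\<chi> i j. w j $ i) \<noteq> 0 \<longleftrightarrow> span (range w) = UNIV"
proof -
  have "columns (\<chi> i j. w j $ i) = range w"
    by (auto simp: columns_def column_def)
  then show ?thesis
    by (simp only: invertible_det_nz[symmetric] invertible_right_inverse
        matrix_right_invertible_span_columns span_vec_eq)
qed

text \<open>At some interior point the first \<open>r\<close> derivatives are independent and span
  all later ones. Finite type at that point makes this span the whole space, and since
  \<open>r\<close> is at most d, these derivatives occur among the columns of the torsion.\<close>

lemma finite_type_imp_torsion_nonzero:
  fixes \<gamma> :: "real \<Rightarrow> real ^ 'n"
  assumes "smooth_curve \<gamma>" "finite_type \<gamma>"
  shows "\<exists>t. 0 < t \<and> t < 1 \<and> torsion \<gamma> t \<noteq> 0"
proof -
  obtain t r where t: "t \<in> {0<..<1::real}"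
    and ind: "inj_on (\<lambda>k. nderiv (Suc k) \<gamma> t) {..<r}"
      "independent ((\<lambda>k. nderiv (Suc k) \<gamma> t) ` {..<r})"
    and all: "\<And>k. nderiv (Suc k) \<gamma> t \<in> span ((\<lambda>k. nderiv (Suc k) \<gamma> t) ` {..<r})"
    using derivatives_in_span_of_initial_independent[of "{0<..<1}" "\<lambda>k. nderiv (Suc k) \<gamma>"]
      nderiv_has_vector_derivative_interior[OF assms(1)] by auto
  have r: "r \<le> CARD('n)"
    using independent_bound[OF ind(2)] ind(1) by (simp add: card_image)
  obtain a where a: "\<forall>k\<in>{1..CARD('n)}. 0 < a k" and det: "det_cols (\<lambda>k. nderiv (a k) \<gamma> t) \<noteq> 0"
    using assms(2) t unfolding finite_type_def
    by (meson atLeastAtMost_iff greaterThanLessThan_iff less_imp_le)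
  have "nderiv (a (column_number j)) \<gamma> t \<in> span ((\<lambda>k. nderiv (Suc k) \<gamma> t) ` {..<r})" for j :: 'n
  proof -
    have "0 < a (column_number j)"
      using a bij_betw_column_number[where 'n='n] by (auto simp: bij_betw_def)
    then show ?thesis using all by (metis Suc_pred)
  qed
  then have "span (range (\<lambda>j::'n. nderiv (a (column_number j)) \<gamma> t))
      \<subseteq> span ((\<lambda>k. nderiv (Suc k) \<gamma> t) ` {..<r})"
    by (intro span_minimal subspace_span) auto
  with det have V: "span ((\<lambda>k. nderiv (Suc k) \<gamma> t) ` {..<r}) = UNIV"
    unfolding det_cols_eq using det_nonzero_iff_span_columns[of "\<lambda>j::'n. nderiv (a (column_number j)) \<gamma> t"]
    by auto
  have "(\<lambda>k. nderiv (Suc k) \<gamma> t) ` {..<r} \<subseteq> range (\<lambda>j::'n. nderiv (column_number j) \<gamma> t)"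
  proof safe
    fix k assume "k < r"
    then have "Suc k \<in> column_number ` (UNIV :: 'n set)"
      using r bij_betw_column_number[where 'n='n] by (auto simp: bij_betw_def)
    then show "nderiv (Suc k) \<gamma> t \<in> range (\<lambda>j::'n. nderiv (column_number j) \<gamma> t)"
      by auto
  qed
  from span_mono[OF this] V have "span (range (\<lambda>j::'n. nderiv (column_number j) \<gamma> t)) = UNIV"
    by auto
  then have "torsion \<gamma> t \<noteq> 0"
    unfolding torsion_def det_cols_eq
    using det_nonzero_iff_span_columns[of "\<lambda>j::'n. nderiv (column_number j) \<gamma> t"] by simp
  with t show ?thesis by auto
qed

section \<open>Taylor expansion of the phase\<close>

text \<open>The term of order m in the Taylor expansion at \<open>t0\<close> is at most
  \<open>c\<close>, because the side \<open>c / \<epsilon> ^ m\<close> offsets the increment. The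
  remainder sits at another point, where the box says nothing directly, so it is bounded through the
  norm of \<open>x\<close>.\<close>

lemma phase_small_on_dual_box:
  fixes \<gamma> :: "real \<Rightarrow> real ^ 'n"
  assumes smooth: "smooth_curve \<gamma>" and t0: "0 < t0" and b: "b < 1" and tors: "torsion \<gamma> t0 \<noteq> 0"
  shows "\<exists>c>0. \<forall>\<epsilon>>0. t0 + \<epsilon> \<le> b \<longrightarrow> (\<forall>x.
    (\<forall>i::'n. \<bar>x \<bullet> nderiv (column_number i) \<gamma> t0\<bar> \<le> c / \<epsilon> ^ column_number i) \<longrightarrow>
    (\<forall>t\<in>{t0..t0 + \<epsilon>}. \<bar>x \<bullet> (\<gamma> t - \<gamma> t0)\<bar> \<le> 1))"
proof -
  define d where "d = CARD('n)"
  have d: "d > 0" by (simp add: d_def)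
  obtain B :: "real ^ 'n ^ 'n" where B: "\<And>x. x = B *v (\<chi> i. x \<bullet> nderiv (column_number i) \<gamma> t0)"
    using invertible_coordinates[of "\<lambda>i. nderiv (column_number i) \<gamma> t0"] tors
    unfolding torsion_def det_cols_eq by metis
  obtain K where K: "K > 0" "\<And>z. norm (B *v z) \<le> norm z * K"
    using bounded_linear.pos_bounded[OF matrix_vector_mul_bounded_linear[of B]] by blast
  obtain M where M: "M > 0" "\<And>t. t \<in> {0..1} \<Longrightarrow> norm (nderiv d \<gamma> t) \<le> M"
    using compact_imp_bounded[OF compact_continuous_image[OF continuous_on_nderiv[OF smooth, of d] compact_Icc]]
    by (auto simp: bounded_pos)
  \<comment> \<open>Chosen so that the lower-order terms, at most \<open>d * c\<close>, and the
    remainder, at most \<open>d * c * K * M\<close>, add up to at most 1.\<close>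
  define c where "c = 1 / (d + d * K * M)"
  have c: "c > 0" using d K M by (auto simp: c_def intro!: add_pos_pos)
  show ?thesis
  proof (intro exI[of _ c] conjI c allI impI ballI)
    fix \<epsilon> x t assume \<epsilon>: "\<epsilon> > 0" "t0 + \<epsilon> \<le> b"
      and x: "\<forall>i::'n. \<bar>x \<bullet> nderiv (column_number i) \<gamma> t0\<bar> \<le> c / \<epsilon> ^ column_number i"
      and t: "t \<in> {t0..t0 + \<epsilon>}"
    have \<epsilon>1: "\<epsilon> \<le> 1" using \<epsilon> t0 b by simp
    have xm: "\<bar>x \<bullet> nderiv m \<gamma> t0\<bar> \<le> c / \<epsilon> ^ m" if "m \<in> {1..d}" for m
    proof -
      have "m \<in> column_number ` (UNIV :: 'n set)"
        using that bij_betw_column_number[where 'n='n] by (auto simp: bij_betw_def d_def)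
      with x show ?thesis by auto
    qed
    \<comment> \<open>As \<open>\<epsilon> \<le> 1\<close>, the longest side of the box is the one
      of order \<open>d\<close>; \<open>B\<close> recovers \<open>x\<close> from its
      coordinates.\<close>
    have norm_x: "norm x \<le> d * c / \<epsilon> ^ d * K"
    proof -
      have "\<bar>x \<bullet> nderiv (column_number i) \<gamma> t0\<bar> \<le> c / \<epsilon> ^ d" for i :: 'n
      proof -
        have "column_number i \<le> d"
          using bij_betw_column_number[where 'n='n] by (auto simp: bij_betw_def d_def)
        then have "c / \<epsilon> ^ column_number i \<le> c / \<epsilon> ^ d"
          using c \<epsilon>(1) \<epsilon>1 by (intro divide_left_mono power_decreasing) auto
        with x show ?thesis by (meson order_trans)
      qed
      then have "norm (\<chi> i::'n. x \<bullet> nderiv (column_number i) \<gamma> t0) \<le> (\<Sum>i\<in>(UNIV::'n set). c / \<epsilon> ^ d)"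
        by (intro order_trans[OF norm_le_l1_cart] sum_mono) simp
      also have "\<dots> = d * c / \<epsilon> ^ d" by (simp add: d_def)
      finally have "norm (\<chi> i::'n. x \<bullet> nderiv (column_number i) \<gamma> t0) * K \<le> d * c / \<epsilon> ^ d * K"
        using K(1) by (intro mult_right_mono) auto
      with K(2)[of "\<chi> i. x \<bullet> nderiv (column_number i) \<gamma> t0"] B[of x, symmetric] show ?thesis by simp
    qed
    show "\<bar>x \<bullet> (\<gamma> t - \<gamma> t0)\<bar> \<le> 1"
    proof (cases "t = t0")
      case False
      with t have "t0 < t" by simp
      define h where "h = t - t0"
      have h: "0 < h" "h \<le> \<epsilon>" using t \<open>t0 < t\<close> by (auto simp: h_def)
      \<comment> \<open>The bounds \<open>0 < t0\<close> and \<open>b < 1\<close> keep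
        \<open>s\<close> in the open interval, where derivatives within \<open>{0..1}\<close> are
        two-sided.\<close>
      have der: "DERIV (\<lambda>s. x \<bullet> nderiv m \<gamma> s) s :> x \<bullet> nderiv (Suc m) \<gamma> s" if "t0 \<le> s" "s \<le> t" for m s
        unfolding has_real_derivative_iff_has_vector_derivative
        using that t0 t \<epsilon> b nderiv_has_vector_derivative_interior[OF smooth, of s m]
        by (intro bounded_linear.has_vector_derivative[OF bounded_linear_inner_right]) auto
      obtain \<xi> where \<xi>: "t0 < \<xi>" "\<xi> < t"
        and taylor: "x \<bullet> \<gamma> t = (\<Sum>m<d. (x \<bullet> nderiv m \<gamma> t0 / fact m) * (t - t0) ^ m)
            + (x \<bullet> nderiv d \<gamma> \<xi> / fact d) * (t - t0) ^ d"
        using Taylor_up[of d "\<lambda>m s. x \<bullet> nderiv m \<gamma> s" "\<lambda>s. x \<bullet> \<gamma> s" t0 t t0] d der \<open>t0 < t\<close>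
        by (auto simp: nderiv_def)
      have "(\<Sum>m<d. (x \<bullet> nderiv m \<gamma> t0 / fact m) * h ^ m)
          = x \<bullet> \<gamma> t0 + (\<Sum>m\<in>{1..<d}. (x \<bullet> nderiv m \<gamma> t0 / fact m) * h ^ m)"
        using d by (simp add: lessThan_atLeast0 sum.atLeast_Suc_lessThan nderiv_def)
      with taylor have eq: "x \<bullet> (\<gamma> t - \<gamma> t0)
          = (\<Sum>m\<in>{1..<d}. (x \<bullet> nderiv m \<gamma> t0 / fact m) * h ^ m) + (x \<bullet> nderiv d \<gamma> \<xi> / fact d) * h ^ d"
        by (simp add: inner_diff_right h_def)
      \<comment> \<open>Serves both the Taylor terms and, with \<open>m = d\<close>, the
        remainder.\<close>
      have term_le: "\<bar>(y / fact m) * h ^ m\<bar> \<le> C" if "\<bar>y\<bar> \<le> C / \<epsilon> ^ m" for y C m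
      proof -
        have "\<bar>(y / fact m) * h ^ m\<bar> = \<bar>y\<bar> / fact m * h ^ m"
          using h by (simp add: abs_mult)
        also have "\<dots> \<le> \<bar>y\<bar> * h ^ m"
          using h fact_ge_1[of m, where 'a=real]
          by (intro mult_right_mono) (auto simp: divide_le_eq mult_le_cancel_left1)
        also have "\<dots> \<le> \<bar>y\<bar> * \<epsilon> ^ m"
          using h by (intro mult_left_mono power_mono) auto
        also have "\<dots> \<le> C"
          using that \<epsilon> by (simp add: pos_le_divide_eq)
        finally show ?thesis .
      qed
      have "\<bar>\<Sum>m\<in>{1..<d}. (x \<bullet> nderiv m \<gamma> t0 / fact m) * h ^ m\<bar> \<le> (\<Sum>m\<in>{1..<d}. c)"
        by (intro order_trans[OF sum_abs] sum_mono term_le xm) auto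
      also have "\<dots> \<le> d * c"
        using c by (simp add: mult_right_mono)
      finally have 1: "\<bar>\<Sum>m\<in>{1..<d}. (x \<bullet> nderiv m \<gamma> t0 / fact m) * h ^ m\<bar> \<le> d * c" .
      have "\<bar>x \<bullet> nderiv d \<gamma> \<xi>\<bar> \<le> norm x * norm (nderiv d \<gamma> \<xi>)"
        by (rule Cauchy_Schwarz_ineq2)
      also have "\<dots> \<le> (d * c / \<epsilon> ^ d * K) * M"
        using norm_x M(2)[of \<xi>] M(1) \<xi> t t0 \<epsilon> b K c by (intro mult_mono) auto
      also have "\<dots> = (d * c * K * M) / \<epsilon> ^ d" by simp
      finally have 2: "\<bar>(x \<bullet> nderiv d \<gamma> \<xi> / fact d) * h ^ d\<bar> \<le> d * c * K * M"
        by (rule term_le)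
      have "\<bar>x \<bullet> (\<gamma> t - \<gamma> t0)\<bar> \<le> d * c + d * c * K * M"
        unfolding eq using 1 2 by linarith
      also have "\<dots> = c * (d + d * K * M)" by (simp add: algebra_simps)
      also have "\<dots> = 1"
        using c by (simp add: c_def)
      finally show ?thesis .
    qed simp
  qed
qed

section \<open>The Knapp example\<close>

text \<open>Dividing out the unimodular constant \<open>exp (\<i> * \<phi> a)\<close> leaves a phase
  in \<open>[-1, 1]\<close>, so the real part of the integrand is at least 1/2 and nothing
  cancels.\<close>

lemma oscillatory_integral_lower_bound:
  fixes \<phi> :: "real \<Rightarrow> real"
  assumes "0 < \<epsilon>" and sub: "{a..a + \<epsilon>} \<subseteq> {0..1}" and cont: "continuous_on {a..a + \<epsilon>} \<phi>"
    and small: "\<And>t. t \<in> {a..a + \<epsilon>} \<Longrightarrow> \<bar>\<phi> t - \<phi> a\<bar> \<le> 1"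
  shows "\<epsilon> / 2 \<le> norm (LINT t | lebesgue_on {0..1}. exp (\<i> * complex_of_real (\<phi> t)) * indicator {a..a + \<epsilon>} t)"
proof -
  define M where "M = lebesgue_on {0..1::real}"
  define g where "g t = indicator {a..a + \<epsilon>} t *\<^sub>R exp (\<i> * complex_of_real (\<phi> t - \<phi> a))" for t
  have fin: "finite_measure M"
    unfolding M_def by (rule finite_measure_lebesgue_on) (simp add: lmeasurable_cbox[of 0 1, simplified])
  have "g \<in> borel_measurable borel"
    unfolding g_def by (intro borel_measurable_continuous_on_indicator continuous_intros cont) auto
  then have meas: "g \<in> borel_measurable M"
    unfolding M_def by (intro measurable_restrict_space1 measurable_completion) simp
  have int: "integrable M g"
    by (rule finite_measure.integrable_const_bound[OF fin _ meas, of 1]) (simp add: g_def indicator_def)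
  \<comment> \<open>Here \<open>1 < pi / 3\<close>, and the cosine of \<open>pi / 3\<close> is
    1/2.\<close>
  have cos: "1 / 2 \<le> cos y" if "\<bar>y\<bar> \<le> 1" for y :: real
  proof -
    have "cos (pi / 3) \<le> cos \<bar>y\<bar>"
      using that pi_gt3 by (intro cos_monotone_0_pi_le) auto
    then show ?thesis by (simp add: cos_60)
  qed
  have "\<epsilon> / 2 = (LINT t | M. indicator {a..a + \<epsilon>} t / 2)"
    using assms(1) sub by (simp add: M_def measure_restrict_space Int_absorb2)
  also have "\<dots> \<le> (LINT t | M. Re (g t))"
  proof (rule integral_mono)
    show "integrable M (\<lambda>t. indicator {a..a + \<epsilon>} t / 2 :: real)"
    proof (rule finite_measure.integrable_const_bound[OF fin, of _ 1])
      have "{a..a + \<epsilon>} \<in> sets M"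
        using sub by (auto simp: M_def sets_restrict_space_iff)
      then show "(\<lambda>t. indicator {a..a + \<epsilon>} t / 2 :: real) \<in> borel_measurable M"
        by measurable
    qed (simp add: indicator_def)
    show "integrable M (\<lambda>t. Re (g t))" using int by simp
    show "indicator {a..a + \<epsilon>} t / 2 \<le> Re (g t)" for t
      using cos[OF small[of t]] by (auto simp: g_def indicator_def Re_exp)
  qed
  also have "\<dots> = Re (LINT t | M. g t)" using int by simp
  also have "\<dots> \<le> norm (LINT t | M. g t)" by (rule complex_Re_le_cmod)
  also have "\<dots> = norm (exp (\<i> * complex_of_real (\<phi> a)) * (LINT t | M. g t))"
    by (simp add: norm_mult)
  also have "exp (\<i> * complex_of_real (\<phi> a)) * (LINT t | M. g t)
      = (LINT t | M. exp (\<i> * complex_of_real (\<phi> t)) * indicator {a..a + \<epsilon>} t)"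
    unfolding integral_mult_right_zero[symmetric]
    by (intro Bochner_Integration.integral_cong refl)
      (auto simp: g_def indicator_def exp_add[symmetric] algebra_simps)
  finally show ?thesis unfolding M_def .
qed

text \<open>If \<open>a < b\<close>, dividing by \<open>\<epsilon> powr a\<close> would bound
  \<open>c\<close> by a quantity that tends to zero with \<open>\<epsilon>\<close>.\<close>

lemma powr_le_powr_near_zero_imp_exponent_le:
  fixes c K \<delta> :: real
  assumes "0 < c" "0 < \<delta>" and le: "\<And>\<epsilon>. 0 < \<epsilon> \<Longrightarrow> \<epsilon> \<le> \<delta> \<Longrightarrow> c * \<epsilon> powr a \<le> K * \<epsilon> powr b"
  shows "b \<le> a"
proof (rule ccontr)
  assume "\<not> b \<le> a"
  then have ab: "0 < b - a" by simp
  have le': "c \<le> K * \<epsilon> powr (b - a)" if "0 < \<epsilon>" "\<epsilon> \<le> \<delta>" for \<epsilon>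
    using le[OF that] that by (simp add: powr_diff field_simps)
  have "0 < K * \<delta> powr (b - a)"
    using le'[of \<delta>] assms by simp
  then have K: "0 < K"
    by (simp add: zero_less_mult_iff)
  \<comment> \<open>The second entry solves
    \<open>K * \<epsilon> powr (b - a) = c / 2\<close>.\<close>
  define \<epsilon> where "\<epsilon> = min \<delta> ((c / (2 * K)) powr (1 / (b - a)))"
  have \<epsilon>: "0 < \<epsilon>" "\<epsilon> \<le> \<delta>" using assms K by (auto simp: \<epsilon>_def)
  have "\<epsilon> powr (b - a) \<le> ((c / (2 * K)) powr (1 / (b - a))) powr (b - a)"
    using \<epsilon> ab by (intro powr_mono2) (auto simp: \<epsilon>_def)
  also have "\<dots> = c / (2 * K)"
    using ab K assms by (simp add: powr_powr)
  finally have "K * \<epsilon> powr (b - a) \<le> c / 2"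
    using K by (simp add: field_simps)
  with le'[OF \<epsilon>] assms(1) show False by simp
qed

section \<open>Norms of the test function and of its transform\<close>

lemma enn2real_inverse_exponent:
  assumes "1 \<le> p" "p \<noteq> \<infinity>"
  shows "1 \<le> enn2real p" "enn2real (1 / p) = 1 / enn2real p"
proof -
  obtain P where P: "p = ennreal P" "P \<ge> 0" using assms by (cases p) auto
  with assms(1) have "1 \<le> P" by simp
  with P show "1 \<le> enn2real p" "enn2real (1 / p) = 1 / enn2real p"
    by (auto simp: divide_ennreal[of 1, simplified])
qed

text \<open>The inverse weight is the test function because it cancels the weight inside
  \<open>Tw\<close>. As \<open>W\<close> lies between positive constants on the interval, the
  cancellation costs only a constant in the norm.\<close>

lemma Lp_norm_inverse_weight_on_short_interval:
  fixes W :: "real \<Rightarrow> real"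
  assumes W [measurable]: "W \<in> borel_measurable (lebesgue_on {0..1})"
    and lo: "0 < lo" and bounds: "\<And>t. t \<in> {a..a + \<delta>} \<Longrightarrow> lo \<le> W t \<and> W t \<le> hi"
    and sub: "{a..a + \<delta>} \<subseteq> {0..1}" and p: "1 \<le> p"
  shows "\<exists>K\<ge>0. \<forall>\<epsilon>>0. \<epsilon> \<le> \<delta> \<longrightarrow>
    (\<lambda>t. indicator {a..a + \<epsilon>} t / complex_of_real (W t)) \<in> Lp_space (weighted_interval W) p \<and>
    Lp_norm (weighted_interval W) p (\<lambda>t. indicator {a..a + \<epsilon>} t / complex_of_real (W t))
      \<le> ennreal (K * \<epsilon> powr enn2real (1 / p))"
proof -
  define K where "K = (if p = \<infinity> then 1 / lo
    else (hi * lo powr (- enn2real p)) powr (1 / enn2real p))"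
  have K: "K \<ge> 0" using lo by (simp add: K_def)
  have "(\<lambda>t. indicator {a..a + \<epsilon>} t / complex_of_real (W t)) \<in> Lp_space (weighted_interval W) p \<and>
    Lp_norm (weighted_interval W) p (\<lambda>t. indicator {a..a + \<epsilon>} t / complex_of_real (W t))
      \<le> ennreal (K * \<epsilon> powr enn2real (1 / p))" if \<epsilon>: "0 < \<epsilon>" "\<epsilon> \<le> \<delta>" for \<epsilon>
  proof -
    define f where "f t = indicator {a..a + \<epsilon>} t / complex_of_real (W t)" for t
    have I: "{a..a + \<epsilon>} \<subseteq> {a..a + \<delta>}" using \<epsilon> by auto
    have [measurable]: "{a..a + \<epsilon>} \<in> sets (lebesgue_on {0..1})"
      using I sub by (auto simp: sets_restrict_space_iff)
    have f [measurable]: "f \<in> borel_measurable (lebesgue_on {0..1})"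
      unfolding f_def by measurable
    then have f': "f \<in> borel_measurable (weighted_interval W)"
      by (simp add: weighted_interval_def)
    have bound: "norm (f t) \<le> indicator {a..a + \<epsilon>} t * (1 / lo)" for t
      using bounds[of t] I lo by (auto simp: f_def indicator_def norm_divide frac_le)
    have "Lp_norm (weighted_interval W) p f \<le> ennreal (K * \<epsilon> powr enn2real (1 / p))"
    proof (cases "p = \<infinity>")
      case True
      have "norm (f t) \<le> 1 / lo" for t
        by (rule order_trans[OF bound]) (use lo in \<open>simp add: indicator_def\<close>)
      then have "esssup (weighted_interval W) (\<lambda>t. ennreal (norm (f t))) \<le> ennreal (1 / lo)"
        using f' by (intro esssup_I AE_I2 ennreal_leI) auto
      \<comment> \<open>For infinite \<open>p\<close> the exponent is 0, so the power of
        \<open>\<epsilon>\<close> equals 1.\<close>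
      with True \<epsilon> show ?thesis by (simp add: Lp_norm_def K_def)
    next
      case False
      define P where "P = enn2real p"
      have P: "1 \<le> P" "enn2real (1 / p) = 1 / P"
        using enn2real_inverse_exponent[OF p False] by (auto simp: P_def)
      define J where "J = (\<integral>\<^sup>+ t. ennreal (norm (f t) powr P) \<partial>weighted_interval W)"
      have hi: "0 < hi" using bounds[of a] lo \<epsilon> by fastforce
      have "J = (\<integral>\<^sup>+ t. ennreal (W t) * ennreal (norm (f t) powr P) \<partial>lebesgue_on {0..1})"
        unfolding J_def weighted_interval_def by (subst nn_integral_density) auto
      also have "\<dots> \<le> (\<integral>\<^sup>+ t. ennreal (hi * lo powr (- P)) * indicator {a..a + \<epsilon>} t \<partial>lebesgue_on {0..1})"
      proof (rule nn_integral_mono)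
        fix t
        show "ennreal (W t) * ennreal (norm (f t) powr P)
            \<le> ennreal (hi * lo powr (- P)) * indicator {a..a + \<epsilon>} t"
        proof (cases "t \<in> {a..a + \<epsilon>}")
          case True
          with bounds[of t] I have Wt: "lo \<le> W t" "W t \<le> hi" by auto
          have "norm (f t) powr P \<le> (1 / lo) powr P"
            using bound[of t] True P by (intro powr_mono2) auto
          also have "\<dots> = lo powr (- P)"
            using lo by (simp add: powr_divide powr_minus_divide)
          finally have "W t * norm (f t) powr P \<le> hi * lo powr (- P)"
            using Wt lo hi by (intro mult_mono) auto
          with True Wt lo show ?thesis
            by (simp add: ennreal_mult[symmetric] ennreal_leI)
        next
          case False
          then show ?thesis by (simp add: f_def)
        qed
      qed
      also have "\<dots> = ennreal (hi * lo powr (- P)) * ennreal \<epsilon>"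
        using I sub \<epsilon> by (subst nn_integral_cmult_indicator)
          (auto simp: emeasure_restrict_space Int_absorb2)
      also have "\<dots> = ennreal (hi * lo powr (- P) * \<epsilon>)"
        using hi \<epsilon> by (simp add: ennreal_mult)
      finally have J: "J \<le> ennreal (hi * lo powr (- P) * \<epsilon>)" .
      then have "J \<noteq> \<infinity>" by (auto simp: top_unique)
      have "enn2real J \<le> hi * lo powr (- P) * \<epsilon>"
        using J hi \<epsilon> by (simp add: enn2real_leI)
      then have "enn2real J powr (1 / P) \<le> (hi * lo powr (- P) * \<epsilon>) powr (1 / P)"
        using P by (intro powr_mono2) auto
      also have "\<dots> = K * \<epsilon> powr (1 / P)"
        using hi \<epsilon> False by (simp add: K_def P_def powr_mult)
      finally show ?thesis
        using False \<open>J \<noteq> \<infinity>\<close> P(2) unfolding Lp_norm_def J_def P_def by (simp add: ennreal_leI)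
    qed
    moreover from this have "f \<in> Lp_space (weighted_interval W) p"
      using f' by (auto simp: Lp_space_def intro: le_less_trans)
    ultimately show ?thesis unfolding f_def by blast
  qed
  with K show ?thesis by blast
qed

text \<open>Chebyshev's inequality for finite exponents. If the integral \<open>J\<close> is
  infinite, so is the norm, and the bound is trivial.\<close>

lemma Lp_norm_lower_bound:
  assumes q: "1 \<le> q" "q \<noteq> \<infinity>" and S: "S \<in> sets M" "ennreal m \<le> emeasure M S" "0 \<le> m" "0 \<le> h"
    and h: "\<And>x. x \<in> S \<Longrightarrow> h \<le> norm (g x)"
  shows "ennreal (h * m powr enn2real (1 / q)) \<le> Lp_norm M q g"
proof -
  define Q where "Q = enn2real q"
  have Q: "1 \<le> Q" "enn2real (1 / q) = 1 / Q"
    using enn2real_inverse_exponent[OF q] by (auto simp: Q_def)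
  define J where "J = (\<integral>\<^sup>+ x. ennreal (norm (g x) powr Q) \<partial>M)"
  have "ennreal (h powr Q * m) = ennreal (h powr Q) * ennreal m"
    using S by (simp add: ennreal_mult)
  also have "\<dots> \<le> ennreal (h powr Q) * emeasure M S"
    using S by (intro mult_left_mono) auto
  also have "\<dots> = (\<integral>\<^sup>+ x. ennreal (h powr Q) * indicator S x \<partial>M)"
    using S by (simp add: nn_integral_cmult_indicator)
  also have "\<dots> \<le> J"
    unfolding J_def using h S Q
    by (intro nn_integral_mono) (auto simp: indicator_def intro!: ennreal_leI powr_mono2)
  finally have J: "ennreal (h powr Q * m) \<le> J" .
  have "h * m powr (1 / Q) \<le> enn2real J powr (1 / Q)" if "J \<noteq> \<infinity>"
  proof -
    have "h * m powr (1 / Q) = (h powr Q * m) powr (1 / Q)"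
      using S Q by (simp add: powr_mult powr_powr)
    also have "\<dots> \<le> enn2real J powr (1 / Q)"
    proof (intro powr_mono2)
      have "enn2real (ennreal (h powr Q * m)) \<le> enn2real J"
        using J that by (intro enn2real_mono) (auto simp: less_top)
      then show "h powr Q * m \<le> enn2real J" using S by simp
    qed (use S Q in auto)
    finally show ?thesis .
  qed
  then show ?thesis
    using q(2) Q(2) unfolding Lp_norm_def J_def Q_def by (simp add: Let_def ennreal_leI)
qed

text \<open>The transform has norm at least a constant times
  \<open>\<epsilon> * \<epsilon> powr (- \<beta> / q)\<close>, the test function at most a constant
  times \<open>\<epsilon> powr (1 / p)\<close>. Keeping \<open>W\<close> general covers the weighted
  and the unweighted estimate at once.\<close>

lemma Knapp_necessary_condition:
  fixes \<gamma> :: "real \<Rightarrow> real ^ 'n" and W :: "real \<Rightarrow> real"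
  assumes W: "W \<in> borel_measurable (lebesgue_on {0..1})"
    and lo: "0 < lo" and bounds: "\<And>t. t \<in> {a..a + \<delta>} \<Longrightarrow> lo \<le> W t \<and> W t \<le> hi"
    and \<delta>: "0 < \<delta>" and sub: "{a..a + \<delta>} \<subseteq> {0..1}"
    and cont: "continuous_on {0..1} \<gamma>"
    and c: "0 < c"
    and box: "\<And>\<epsilon>. 0 < \<epsilon> \<Longrightarrow> \<epsilon> \<le> \<delta> \<Longrightarrow> \<exists>S\<in>sets \<mu>. ennreal (c * \<epsilon> powr (- \<beta>)) \<le> emeasure \<mu> S
        \<and> (\<forall>x\<in>S. \<forall>t\<in>{a..a + \<epsilon>}. \<bar>x \<bullet> (\<gamma> t - \<gamma> a)\<bar> \<le> 1)"
    and p: "1 \<le> p" and q: "1 \<le> q"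
    and est: "\<And>f. f \<in> Lp_space (weighted_interval W) p \<Longrightarrow>
      Lp_norm \<mu> q (Tw \<gamma> 1 W f) \<le> ennreal C * Lp_norm (weighted_interval W) p f"
  shows "\<beta> * enn2real (1 / q) + enn2real (1 / p) \<le> 1"
proof (cases "q = \<infinity>")
  \<comment> \<open>Here \<open>1 / q\<close> is 0, and only \<open>1 / p \<le> 1\<close>
    remains.\<close>
  case True
  then show ?thesis
    using enn2real_inverse_exponent[OF p] by (cases "p = \<infinity>") auto
next
  case False
  define s where "s = enn2real (1 / q)"
  obtain K where K: "K \<ge> 0" and norm_f: "\<And>\<epsilon>. 0 < \<epsilon> \<Longrightarrow> \<epsilon> \<le> \<delta> \<Longrightarrow>
    (\<lambda>t. indicator {a..a + \<epsilon>} t / complex_of_real (W t)) \<in> Lp_space (weighted_interval W) p \<and>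
    Lp_norm (weighted_interval W) p (\<lambda>t. indicator {a..a + \<epsilon>} t / complex_of_real (W t))
      \<le> ennreal (K * \<epsilon> powr enn2real (1 / p))"
    using Lp_norm_inverse_weight_on_short_interval[OF W lo bounds sub p] by blast
  have "enn2real (1 / p) \<le> 1 - \<beta> * s"
  proof (rule powr_le_powr_near_zero_imp_exponent_le)
    show "0 < c powr s / 2" using c by simp
    show "0 < \<delta>" by fact
    fix \<epsilon> assume \<epsilon>: "0 < \<epsilon>" "\<epsilon> \<le> \<delta>"
    define f where "f t = indicator {a..a + \<epsilon>} t / complex_of_real (W t)" for t
    obtain S where S: "S \<in> sets \<mu>" "ennreal (c * \<epsilon> powr (- \<beta>)) \<le> emeasure \<mu> S"
      and phase: "\<And>x t. x \<in> S \<Longrightarrow> t \<in> {a..a + \<epsilon>} \<Longrightarrow> \<bar>x \<bullet> (\<gamma> t - \<gamma> a)\<bar> \<le> 1"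
      using box[OF \<epsilon>] by blast
    have I: "{a..a + \<epsilon>} \<subseteq> {a..a + \<delta>}" using \<epsilon> by auto
    have Tw: "\<epsilon> / 2 \<le> norm (Tw \<gamma> 1 W f x)" if x: "x \<in> S" for x
    proof -
      have "Tw \<gamma> 1 W f x
          = (LINT t | lebesgue_on {0..1}. exp (\<i> * complex_of_real (x \<bullet> \<gamma> t)) * indicator {a..a + \<epsilon>} t)"
        unfolding Tw_def
        using bounds I lo
        by (intro Bochner_Integration.integral_cong refl) (fastforce simp: f_def indicator_def)
      moreover have "continuous_on {a..a + \<epsilon>} (\<lambda>t. x \<bullet> \<gamma> t)"
        using I sub by (intro continuous_intros continuous_on_subset[OF cont]) auto
      ultimately show ?thesis
        using oscillatory_integral_lower_bound[of \<epsilon> a "\<lambda>t. x \<bullet> \<gamma> t"] \<epsilon>(1) I sub phase[OF x]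
        by (simp add: inner_diff_right)
    qed
    have "c powr s / 2 * \<epsilon> powr (1 - \<beta> * s) = \<epsilon> / 2 * (c * \<epsilon> powr (- \<beta>)) powr s"
      using c \<epsilon>(1) by (simp add: powr_mult powr_powr powr_diff powr_minus_divide powr_divide)
    then have "ennreal (c powr s / 2 * \<epsilon> powr (1 - \<beta> * s)) \<le> Lp_norm \<mu> q (Tw \<gamma> 1 W f)"
      unfolding s_def
      using Lp_norm_lower_bound[OF q False S, of "\<epsilon> / 2" "Tw \<gamma> 1 W f"] Tw c \<epsilon>(1) by simp
    also have "\<dots> \<le> ennreal C * Lp_norm (weighted_interval W) p f"
      using est norm_f[OF \<epsilon>] unfolding f_def by blast
    also have "\<dots> \<le> ennreal C * ennreal (K * \<epsilon> powr enn2real (1 / p))"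
      using norm_f[OF \<epsilon>] unfolding f_def by (intro mult_left_mono) auto
    \<comment> \<open>\<open>C\<close> may be negative; \<open>ennreal\<close> then truncates it to
      0.\<close>
    also have "\<dots> = ennreal (max 0 C * (K * \<epsilon> powr enn2real (1 / p)))"
      using K by (simp add: ennreal_mult ennreal_max_0)
    finally show "c powr s / 2 * \<epsilon> powr (1 - \<beta> * s) \<le> max 0 C * K * \<epsilon> powr enn2real (1 / p)"
      using K by (simp add: mult.assoc)
  qed
  then show ?thesis by (simp add: s_def)
qed

section \<open>The critical measure\<close>

text \<open>With \<open>j\<close> as in the definition of \<open>beta\<close>, the exponents for \<open>k = 1, \<dots>, d\<close> are \<open>j\<close> zeros, then
  \<open>\<alpha> - (d - j - 1)\<close>, then ones.\<close>

definition Knapp_exponent :: "nat \<Rightarrow> real \<Rightarrow> nat \<Rightarrow> real" where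
  "Knapp_exponent d \<alpha> k = max 0 (min 1 (\<alpha> - (real d - real k)))"

text \<open>The first sum is the growth exponent on balls; the second is the exponent of
  \<open>1 / \<epsilon>\<close> in the measure of the box with sides of order
  \<open>\<epsilon> powr (- k)\<close>.\<close>

lemma Knapp_exponent_sums:
  assumes "0 < \<alpha>" "\<alpha> \<le> real d"
  shows "(\<Sum>k=1..d. Knapp_exponent d \<alpha> k) = \<alpha>"
    and "(\<Sum>k=1..d. real k * Knapp_exponent d \<alpha> k) = beta d \<alpha>"
proof -
  \<comment> \<open>This is \<open>d - j - 1\<close>: the half-open interval from \<open>m\<close>
    (excluded) to \<open>m + 1\<close> (included) contains \<alpha>.\<close>
  define m where "m = nat (\<lceil>\<alpha>\<rceil> - 1)"
  have m: "real m < \<alpha>" "\<alpha> \<le> real m + 1"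
    using assms unfolding m_def by linarith+
  with assms have "m < d" by linarith
  then obtain j where d: "d = j + 1 + m"
    using less_iff_Suc_add[of m d] by auto
  have "(THE j. j < d \<and> real d - real j - 1 < \<alpha> \<and> \<alpha> \<le> real d - real j) = j"
    using m d by (intro the_equality) auto
  then have beta: "beta d \<alpha> = (real j + 1) * \<alpha> + real m * (real m + 1) / 2"
    by (simp add: beta_def d)
  have vals: "Knapp_exponent d \<alpha> k = (if k \<le> j then 0 else if k = j + 1 then \<alpha> - m else 1)" for k
  proof -
    consider "k \<le> j" | "k = j + 1" | "k \<ge> j + 2" by linarith
    then show ?thesis
    proof cases
      case 1
      then have "real k \<le> real j" by simp
      with 1 m show ?thesis unfolding Knapp_exponent_def d by simp
    next
      case 2
      with m show ?thesis unfolding Knapp_exponent_def d by simp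
    next
      case 3
      then have "real k \<ge> real j + 2" by simp
      with 3 m show ?thesis unfolding Knapp_exponent_def d by simp
    qed
  qed
  define \<theta> where "\<theta> k = (if k \<le> j then 0 else if k = j + 1 then \<alpha> - m else 1::real)" for k
  have \<theta>_eq: "Knapp_exponent d \<alpha> = \<theta>"
    by (rule ext) (simp add: vals \<theta>_def)
  \<comment> \<open>The induction runs over the number \<open>n\<close> of trailing ones;
    \<open>n = m\<close> gives the full sums.\<close>
  have 1: "(\<Sum>k=1..j + 1 + n. \<theta> k) = \<alpha> - m + n" for n
    by (induction n) (simp_all add: \<theta>_def)
  have 2: "(\<Sum>k=1..j + 1 + n. real k * \<theta> k)
      = (real j + 1) * (\<alpha> - m) + real n * (real j + 1) + real n * (real n + 1) / 2" for n
    by (induction n) (simp_all add: \<theta>_def field_simps)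
  show "(\<Sum>k=1..d. Knapp_exponent d \<alpha> k) = \<alpha>"
    using 1[of m, folded d] by (simp add: \<theta>_eq)
  show "(\<Sum>k=1..d. real k * Knapp_exponent d \<alpha> k) = beta d \<alpha>"
    unfolding beta using 2[of m, folded d] by (simp add: \<theta>_eq algebra_simps)
qed

section \<open>Necessity of the relation between the exponents\<close>

theorem mainTheorem3:
  fixes \<gamma> :: "real \<Rightarrow> real ^ 'n" and \<alpha> :: real
  assumes "CARD('n) \<ge> 2"
    and "smooth_curve \<gamma>" and "finite_type \<gamma>"
    and "0 < \<alpha>" and "\<alpha> \<le> real CARD('n)"
  shows "\<exists>(\<mu> :: (real ^ 'n) measure) (C\<mu> :: real).
    sets \<mu> = sets borel \<and>
    (\<forall>x \<rho>. \<rho> > 0 \<longrightarrow> emeasure \<mu> (ball x \<rho>) \<le> ennreal (C\<mu> * \<rho> powr \<alpha>)) \<and>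
    (\<forall>p q :: ennreal. 1 \<le> p \<longrightarrow> 1 \<le> q \<longrightarrow>
       (\<exists>C::real. \<forall>lam\<ge>1. \<forall>f \<in> Lp_space (weighted_interval (weight \<gamma> \<alpha>)) p.
          Lp_norm \<mu> q (Tw \<gamma> lam (weight \<gamma> \<alpha>) f)
            \<le> ennreal (C * lam powr (- \<alpha> * enn2real (1 / q)))
              * Lp_norm (weighted_interval (weight \<gamma> \<alpha>)) p f) \<longrightarrow>
       beta CARD('n) \<alpha> * enn2real (1 / q) + enn2real (1 / p) \<le> 1) \<and>
    ((\<forall>t\<in>{0..1}. torsion \<gamma> t \<noteq> 0) \<longrightarrow>
     (\<forall>p q :: ennreal. 1 \<le> p \<longrightarrow> 1 \<le> q \<longrightarrow>
       (\<exists>C::real. \<forall>lam\<ge>1. \<forall>f \<in> Lp_space (lebesgue_on {0..1}) p.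
          Lp_norm \<mu> q (T \<gamma> lam f)
            \<le> ennreal (C * lam powr (- \<alpha> * enn2real (1 / q)))
              * Lp_norm (lebesgue_on {0..1}) p f) \<longrightarrow>
       beta CARD('n) \<alpha> * enn2real (1 / q) + enn2real (1 / p) \<le> 1))"
proof -
  define \<beta> where "\<beta> = beta CARD('n) \<alpha>"
  define \<theta> where "\<theta> i = Knapp_exponent CARD('n) \<alpha> (column_number i)" for i :: 'n
  have \<theta>: "0 \<le> \<theta> i" "\<theta> i \<le> 1" for i
    by (auto simp: \<theta>_def Knapp_exponent_def)
  have sum_\<theta>: "(\<Sum>i\<in>UNIV. \<theta> i) = \<alpha>" "(\<Sum>i\<in>UNIV. column_number i * \<theta> i) = \<beta>"
    using Knapp_exponent_sums[OF assms(4,5)]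
      sum_column_number[where 'n='n, of "Knapp_exponent CARD('n) \<alpha>"]
      sum_column_number[where 'n='n, of "\<lambda>k. k * Knapp_exponent CARD('n) \<alpha> k"]
    by (simp_all add: \<theta>_def \<beta>_def)
  have tcont: "continuous_on {0..1} (torsion \<gamma>)"
    by (rule continuous_on_torsion) fact
  have \<gamma>cont: "continuous_on {0..1} \<gamma>"
    using continuous_on_nderiv[OF assms(2), of 0] by (simp add: nderiv_def)
  obtain t0 where t0: "0 < t0" "t0 < 1" "torsion \<gamma> t0 \<noteq> 0"
    using finite_type_imp_torsion_nonzero[OF assms(2,3)] by blast
  have "isCont (torsion \<gamma>) t0"
    using tcont t0 by (intro continuous_on_interior) auto
  then have "\<forall>\<^sub>F t in at t0. torsion \<gamma> t \<noteq> 0"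
    using t0(3) by (auto simp: isCont_def intro: tendsto_imp_eventually_ne)
  then obtain e where e: "e > 0" "\<And>t. t \<noteq> t0 \<Longrightarrow> dist t t0 < e \<Longrightarrow> torsion \<gamma> t \<noteq> 0"
    unfolding eventually_at by auto
  \<comment> \<open>The halves keep the closed interval \<open>{t0..t0 + \<delta>}\<close> inside
    the region of nonzero torsion and away from the endpoint 1.\<close>
  define \<delta> where "\<delta> = min (e / 2) ((1 - t0) / 2)"
  have \<delta>: "0 < \<delta>" "t0 + \<delta> < 1" "{t0..t0 + \<delta>} \<subseteq> {0..1}"
    using e t0 by (auto simp: \<delta>_def min_def field_simps)
  have tne: "torsion \<gamma> t \<noteq> 0" if "t \<in> {t0..t0 + \<delta>}" for t
    using that t0(3) e(1) e(2)[of t] min.cobounded1[of "e / 2" "(1 - t0) / 2"]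
    by (cases "t = t0") (auto simp: \<delta>_def[symmetric] dist_real_def)
  obtain c where c: "c > 0"
    and phase': "\<forall>\<epsilon>>0. t0 + \<epsilon> \<le> t0 + \<delta> \<longrightarrow> (\<forall>x.
      (\<forall>i::'n. \<bar>x \<bullet> nderiv (column_number i) \<gamma> t0\<bar> \<le> c / \<epsilon> ^ column_number i) \<longrightarrow>
      (\<forall>t\<in>{t0..t0 + \<epsilon>}. \<bar>x \<bullet> (\<gamma> t - \<gamma> t0)\<bar> \<le> 1))"
    using phase_small_on_dual_box[OF assms(2) t0(1) \<delta>(2) t0(3)] by blast
  have phase: "\<And>\<epsilon> x t. \<epsilon> > 0 \<Longrightarrow> \<epsilon> \<le> \<delta>
      \<Longrightarrow> (\<And>i::'n. \<bar>x \<bullet> nderiv (column_number i) \<gamma> t0\<bar> \<le> c / \<epsilon> ^ column_number i)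
      \<Longrightarrow> t \<in> {t0..t0 + \<epsilon>} \<Longrightarrow> \<bar>x \<bullet> (\<gamma> t - \<gamma> t0)\<bar> \<le> 1"
    using phase' by simp
  have "det (\<chi> i j. nderiv (column_number j) \<gamma> t0 $ i) \<noteq> 0"
    using t0(3) by (simp add: torsion_def det_cols_eq)
  from anisotropic_growth_measure[where \<theta> = \<theta>, OF this \<theta>]
  obtain \<mu> :: "(real ^ 'n) measure" where sets: "sets \<mu> = sets borel"
    and ex_growth: "\<exists>C. \<forall>x. \<forall>\<rho>>0. emeasure \<mu> (ball x \<rho>) \<le> ennreal (C * \<rho> powr \<alpha>)"
    and ex_box: "\<exists>c>0. \<forall>r. (\<forall>i. r i > 0) \<longrightarrow> ennreal (c * (\<Prod>i\<in>UNIV. r i powr \<theta> i))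
      \<le> emeasure \<mu> {x. \<forall>i. \<bar>x \<bullet> nderiv (column_number i) \<gamma> t0\<bar> \<le> r i}"
    unfolding sum_\<theta> by blast
  obtain C\<mu> where growth: "\<forall>x. \<forall>\<rho>>0. emeasure \<mu> (ball x \<rho>) \<le> ennreal (C\<mu> * \<rho> powr \<alpha>)"
    using ex_growth by blast
  obtain c' where c': "c' > 0" "\<And>r. (\<And>i. r i > 0) \<Longrightarrow> ennreal (c' * (\<Prod>i\<in>UNIV. r i powr \<theta> i))
      \<le> emeasure \<mu> {x. \<forall>i. \<bar>x \<bullet> nderiv (column_number i) \<gamma> t0\<bar> \<le> r i}"
    using ex_box by blast
  \<comment> \<open>With sides \<open>c / \<epsilon> ^ k\<close>, the product of the powers
    collapses to \<open>c powr \<alpha> * \<epsilon> powr (- \<beta>)\<close> by the two exponent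
    sums.\<close>
  have box: "\<exists>S\<in>sets \<mu>. ennreal (c' * c powr \<alpha> * \<epsilon> powr (- \<beta>)) \<le> emeasure \<mu> S
        \<and> (\<forall>x\<in>S. \<forall>t\<in>{t0..t0 + \<epsilon>}. \<bar>x \<bullet> (\<gamma> t - \<gamma> t0)\<bar> \<le> 1)" if \<epsilon>: "0 < \<epsilon>" "\<epsilon> \<le> \<delta>" for \<epsilon>
  proof (intro bexI conjI ballI)
    define r where "r i = c / \<epsilon> ^ column_number i" for i :: 'n
    let ?S = "{x. \<forall>i. \<bar>x \<bullet> nderiv (column_number i) \<gamma> t0\<bar> \<le> r i}"
    have "r i powr \<theta> i = c powr \<theta> i * \<epsilon> powr (- (column_number i * \<theta> i))" for i
      using c \<epsilon>
      by (simp add: r_def powr_divide powr_minus_divide powr_powr powr_realpow[symmetric])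
    then have "(\<Prod>i\<in>UNIV. r i powr \<theta> i) = c powr \<alpha> * \<epsilon> powr (- \<beta>)"
      using c \<epsilon> sum_\<theta> by (simp add: prod.distrib powr_sum[symmetric] sum_negf)
    then show "ennreal (c' * c powr \<alpha> * \<epsilon> powr (- \<beta>)) \<le> emeasure \<mu> ?S"
      using c'(2)[of r] c \<epsilon> by (simp add: r_def mult.assoc)
    have "closed ?S"
      by (intro closed_Collect_all closed_Collect_le continuous_intros)
    then show "?S \<in> sets \<mu>"
      unfolding sets by (rule borel_closed)
    show "\<bar>x \<bullet> (\<gamma> t - \<gamma> t0)\<bar> \<le> 1" if "x \<in> ?S" "t \<in> {t0..t0 + \<epsilon>}" for x t
      using that by (intro phase[OF \<epsilon>]) (auto simp: r_def)
  qed
  have c'': "0 < c' * c powr \<alpha>" using c c' by simp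
  note Knapp = Knapp_necessary_condition[where \<mu> = \<mu> and \<beta> = \<beta>, OF _ _ _ \<delta>(1,3) \<gamma>cont c'' box]
  define W where "W = weight \<gamma> \<alpha>"
  have W: "W \<in> borel_measurable (lebesgue_on {0..1})"
  proof -
    have [measurable]: "torsion \<gamma> \<in> borel_measurable (lebesgue_on {0..1})"
      by (rule continuous_imp_measurable_on_sets_lebesgue[OF tcont]) simp
    show ?thesis unfolding W_def weight_def[abs_def] by measurable
  qed
  \<comment> \<open>Nonzero torsion makes the power continuous here, so compactness gives positive
    bounds \<open>W t1\<close> and \<open>W t2\<close> for the weight.\<close>
  have Wcont: "continuous_on {t0..t0 + \<delta>} W"
    unfolding W_def weight_def[abs_def]
    using tne by (intro continuous_intros continuous_on_subset[OF tcont] \<delta>(3)) auto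
  have ne: "{t0..t0 + \<delta>} \<noteq> {}" using \<delta>(1) by simp
  obtain t1 where t1: "t1 \<in> {t0..t0 + \<delta>}" "\<forall>t\<in>{t0..t0 + \<delta>}. W t1 \<le> W t"
    using continuous_attains_inf[OF compact_Icc ne Wcont] by blast
  obtain t2 where t2: "t2 \<in> {t0..t0 + \<delta>}" "\<forall>t\<in>{t0..t0 + \<delta>}. W t \<le> W t2"
    using continuous_attains_sup[OF compact_Icc ne Wcont] by blast
  have Wpos: "0 < W t1"
    using tne[OF t1(1)] by (simp add: W_def weight_def)
  show ?thesis
  proof (intro exI[of _ \<mu>] exI[of _ C\<mu>] conjI allI impI)
    fix p q :: ennreal assume pq: "1 \<le> p" "1 \<le> q"
      and "\<exists>C::real. \<forall>lam\<ge>1. \<forall>f \<in> Lp_space (weighted_interval (weight \<gamma> \<alpha>)) p.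
          Lp_norm \<mu> q (Tw \<gamma> lam (weight \<gamma> \<alpha>) f)
            \<le> ennreal (C * lam powr (- \<alpha> * enn2real (1 / q)))
              * Lp_norm (weighted_interval (weight \<gamma> \<alpha>)) p f"
    \<comment> \<open>At \<open>lam = 1\<close> the power of \<open>lam\<close> is 1, whatever its
      exponent.\<close>
    then obtain C where "\<And>f. f \<in> Lp_space (weighted_interval W) p \<Longrightarrow>
        Lp_norm \<mu> q (Tw \<gamma> 1 W f) \<le> ennreal C * Lp_norm (weighted_interval W) p f"
      unfolding W_def by (metis mult.right_neutral order_refl powr_one_eq_one)
    with pq t1 t2 show "beta CARD('n) \<alpha> * enn2real (1 / q) + enn2real (1 / p) \<le> 1"
      unfolding \<beta>_def[symmetric] by (intro Knapp[OF W Wpos, of "W t2"]) auto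
  next
    fix p q :: ennreal assume pq: "1 \<le> p" "1 \<le> q"
      and "\<exists>C::real. \<forall>lam\<ge>1. \<forall>f \<in> Lp_space (lebesgue_on {0..1}) p.
          Lp_norm \<mu> q (T \<gamma> lam f)
            \<le> ennreal (C * lam powr (- \<alpha> * enn2real (1 / q)))
              * Lp_norm (lebesgue_on {0..1}) p f"
    then obtain C where C: "\<And>f. f \<in> Lp_space (lebesgue_on {0..1}) p \<Longrightarrow>
        Lp_norm \<mu> q (T \<gamma> 1 f) \<le> ennreal C * Lp_norm (lebesgue_on {0..1}) p f"
      by (metis mult.right_neutral order_refl powr_one_eq_one)
    \<comment> \<open>The constant weight 1 turns the unweighted estimate into an instance of the
      weighted one, with the same \<mu>.\<close>
    have "weighted_interval (\<lambda>t. 1) = lebesgue_on {0..1}"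
      by (simp add: weighted_interval_def density_1)
    moreover have "Tw \<gamma> 1 (\<lambda>t. 1) = T \<gamma> 1"
      by (intro ext) (simp add: Tw_def T_def)
    ultimately show "beta CARD('n) \<alpha> * enn2real (1 / q) + enn2real (1 / p) \<le> 1"
      unfolding \<beta>_def[symmetric] using pq C
      by (intro Knapp[where W = "\<lambda>t. 1" and lo = 1 and hi = 1]) auto
  qed (use sets growth in auto)
qed

end
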